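(* Let $\Omega\subset\mathbb{R}^n$ be an open set and let $V$ be a $d$-varifold in $\Omega$ with bounded variations. Then, for all $i,j,k=1,\dots,n$ (identities between functions being understood $\|V\|$-almost everywhere): \begin{enumerate} \item $\delta_{ijk}V=\delta_{ikj}V$, $\ \beta^V_{ijk}=\beta^V_{ikj}$ and $A^V_{ijk}=A^V_{ikj}$; \item $\displaystyle\sum_q\beta^V_{iqq}=d\,H^V_i$ and $\displaystyle\sum_q\beta^V_{qiq}=H^V_i$, where $H^V=(H^V_1,\dots,H^V_n)=-\frac{\delta V}{\|V\|}$ is the generalized mean curvature vector; \item $\displaystyle\sum_qA^V_{q\cdot q}=(I+c^V)^{-1}H^V$ and $\displaystyle\sum_qA^V_{\cdot qq}=d\,c^V(I+c^V)^{-1}H^V$. \end{enumerate}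
   Context: Fix integers $1\le d\le n$; $e_1,\dots,e_n$ is the canonical basis of $\mathbb{R}^n$. $G_{d,n}$ is the Grassmannian of $d$-dimensional linear subspaces of $\mathbb{R}^n$; each $S\in G_{d,n}$ is identified with the matrix $(S_{jk})$ of the orthogonal projection onto $S$. A $d$-varifold $V$ in $\Omega$ is a non-negative Radon measure on $\Omega\times G_{d,n}$; its mass is $\|V\|(B)=V(B\times G_{d,n})$, and it disintegrates as $V=\|V\|\otimes\nu_x$ with probability measures $\nu_x$ on $G_{d,n}$ for $\|V\|$-a.e. $x$. For $\varphi\in C^1$, $\nabla^S\varphi=S\nabla\varphi$. The $G$-linear variations are the distributions $\delta_{ijk}V(\varphi)=\int_{\Omega\times G_{d,n}}S_{jk}\,\nabla^S\varphi(y)\cdot e_i\,dV(y,S)$, $\varphi\in C_c^1(\Omega)$. $V$ has (locally) bounded variations if all $\delta_{ijk}V$ are (signed) Radon measures; then $\beta^V_{ijk}\in L^1_{loc}(\|V\|)$ is defined by $\delta_{ijk}V=-\beta^V_{ijk}\|V\|+(\delta_{ijk}V)_s$ with $(\delta_{ijk}V)_s$ singular with respect to $\|V\|$. Put $c^V(x)=\int_{G_{d,n}}S\,d\nu_x(S)$. The weak second fundamental form $A^V=(A^V_{ijk})$ is, for $\|V\|$-a.e. $x$, the unique solution of the linear system $A^V_{ijk}(x)+c^V_{jk}(x)\sum_qA^V_{qiq}(x)=\beta^V_{ijk}(x)$, $i,j,k=1,\dots,n$. The first variation is the vector-valued distribution $\delta V(\varphi)=\int_{\Omega\times G_{d,n}}\nabla^S\varphi(y)\,dV(y,S)$,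 $\varphi\in C_c^1(\Omega)$; it is a vector Radon measure when $V$ has bounded variations, and $-\frac{\delta V}{\|V\|}$ denotes minus its Radon–Nikodym density with respect to $\|V\|$ (i.e. $\delta V=-H^V\|V\|+\delta V_s$ with $\delta V_s$ singular). A dot in an index position denotes the vector obtained by letting this index vary: $\sum_qA_{q\cdot q}$ has $i$-th component $\sum_qA_{qiq}$, and $\sum_qA_{\cdot qq}$ has $i$-th component $\sum_qA_{iqq}$. *)

theory Defs
  imports "HOL-Probability.Probability"
begin

section \<open>The Grassmannian\<close>

definition is_orthogonal_projection :: "real^'n^'n \<Rightarrow> (real^'n) set \<Rightarrow> bool" where
  "is_orthogonal_projection S T \<longleftrightarrow>
     (\<forall>x. S *v x \<in> T \<and> (\<forall>y\<in>T. (x - S *v x) \<bullet> y = 0))"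

text \<open>Subspaces are identified with the matrices of their orthogonal projections.\<close>

definition grassmannian :: "nat \<Rightarrow> (real^'n^'n) set" where
  "grassmannian d = {S. \<exists>T. subspace T \<and> dim T = d \<and> is_orthogonal_projection S T}"


section \<open>Test functions and Radon measures\<close>

definition gradient :: "('a::real_inner \<Rightarrow> real) \<Rightarrow> 'a \<Rightarrow> 'a" where
  "gradient \<phi> x = (THE D. GDERIV \<phi> x :> D)"

text \<open>Elements of \<open>C\<^sub>c\<^sup>1(\<Omega>)\<close> are taken to be extended by zero to the whole space.\<close>

definition C1c :: "'a::euclidean_space set \<Rightarrow> ('a \<Rightarrow> real) set" where
  "C1c \<Omega> = {\<phi>. \<phi> differentiable_on UNIV \<and> continuous_on UNIV (gradient \<phi>) \<and>
     compact (closure {x. \<phi> x \<noteq> 0}) \<and> closure {x. \<phi> x \<noteq> 0} \<subseteq> \<Omega>}"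

text \<open>
  Regularity is automatic on the spaces used below (an open set, or the product of an open set
  with a compact set), so a Radon measure is a Borel measure that is finite on compact sets.
\<close>

definition radon_measure_on :: "'a::topological_space set \<Rightarrow> 'a measure \<Rightarrow> bool" where
  "radon_measure_on X M \<longleftrightarrow>
     sets M = sets (restrict_space borel X) \<and>
     (\<forall>K. compact K \<longrightarrow> K \<subseteq> X \<longrightarrow> emeasure M K < \<infinity>)"

text \<open>
  A signed Radon measure on an open set need not be a set function with values in the extended
  reals, as both its positive and its negative part may be infinite. It is therefore given as
  a difference of two positive Radon measures, acting on test functions.
\<close>

definition is_signed_radon ::
    "'a::euclidean_space set \<Rightarrow> (('a \<Rightarrow> real) \<Rightarrow> real) \<Rightarrow> bool" where
  "is_signed_radon \<Omega> L \<longleftrightarrow>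
     (\<exists>\<sigma> \<tau>. radon_measure_on \<Omega> \<sigma> \<and> radon_measure_on \<Omega> \<tau> \<and>
        (\<forall>\<phi>\<in>C1c \<Omega>. L \<phi> = (\<integral>x. \<phi> x \<partial>\<sigma>) - (\<integral>x. \<phi> x \<partial>\<tau>)))"

definition singular_wrt :: "'a measure \<Rightarrow> 'a measure \<Rightarrow> bool" where
  "singular_wrt \<sigma> M \<longleftrightarrow>
     (\<exists>N\<in>sets M. emeasure M N = 0 \<and> emeasure \<sigma> (space M - N) = 0)"

definition L1_loc :: "'a::topological_space set \<Rightarrow> 'a measure \<Rightarrow> ('a \<Rightarrow> real) set" where
  "L1_loc \<Omega> M = {f \<in> borel_measurable M.
     \<forall>K. compact K \<longrightarrow> K \<subseteq> \<Omega> \<longrightarrow> set_integrable M K f}"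

text \<open>
  \<open>f\<close> is the Radon--Nikodym density of the absolutely continuous part in the Lebesgue
  decomposition \<open>L = f M + (\<sigma> - \<tau>)\<close> of the signed Radon measure \<open>L\<close>.
\<close>

definition is_ac_density ::
    "'a::euclidean_space set \<Rightarrow> 'a measure \<Rightarrow> (('a \<Rightarrow> real) \<Rightarrow> real) \<Rightarrow> ('a \<Rightarrow> real) \<Rightarrow> bool" where
  "is_ac_density \<Omega> M L f \<longleftrightarrow>
     f \<in> L1_loc \<Omega> M \<and>
     (\<exists>\<sigma> \<tau>. radon_measure_on \<Omega> \<sigma> \<and> radon_measure_on \<Omega> \<tau> \<and>
        singular_wrt \<sigma> M \<and> singular_wrt \<tau> M \<and>
        (\<forall>\<phi>\<in>C1c \<Omega>. L \<phi> = (\<integral>x. f x * \<phi> x \<partial>M) + ((\<integral>x. \<phi> x \<partial>\<sigma>) - (\<integral>x. \<phi> x \<partial>\<tau>))))"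

text \<open>Like \<^const>\<open>RN_deriv\<close>, this picks one of the versions, which agree almost everywhere.\<close>

definition ac_density ::
    "'a::euclidean_space set \<Rightarrow> 'a measure \<Rightarrow> (('a \<Rightarrow> real) \<Rightarrow> real) \<Rightarrow> 'a \<Rightarrow> real" where
  "ac_density \<Omega> M L = (SOME f. is_ac_density \<Omega> M L f)"


section \<open>Varifolds\<close>

definition varifold ::
    "nat \<Rightarrow> (real^'n) set \<Rightarrow> ((real^'n) \<times> (real^'n^'n)) measure \<Rightarrow> bool" where
  "varifold d \<Omega> V \<longleftrightarrow> radon_measure_on (\<Omega> \<times> grassmannian d) V"

definition mass ::
    "(real^'n) set \<Rightarrow> ((real^'n) \<times> (real^'n^'n)) measure \<Rightarrow> (real^'n) measure" where
  "mass \<Omega> V = distr V (restrict_space borel \<Omega>) fst"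

text \<open>The disintegration \<open>V = \<parallel>V\<parallel> \<otimes> \<nu>\<^sub>x\<close>.\<close>

definition disintegration ::
    "nat \<Rightarrow> (real^'n) set \<Rightarrow> ((real^'n) \<times> (real^'n^'n)) measure
      \<Rightarrow> (real^'n \<Rightarrow> (real^'n^'n) measure) \<Rightarrow> bool" where
  "disintegration d \<Omega> V \<nu> \<longleftrightarrow>
     (AE x in mass \<Omega> V. prob_space (\<nu> x) \<and>
        sets (\<nu> x) = sets (restrict_space borel (grassmannian d))) \<and>
     (\<forall>B\<in>sets (restrict_space borel (grassmannian d)).
        (\<lambda>x. emeasure (\<nu> x) B) \<in> borel_measurable (mass \<Omega> V)) \<and>
     (\<forall>B\<in>sets V. emeasure V B = (\<integral>\<^sup>+x. emeasure (\<nu> x) (Pair x -` B) \<partial>mass \<Omega> V))"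

definition G_variation ::
    "((real^'n) \<times> (real^'n^'n)) measure \<Rightarrow> 'n \<Rightarrow> 'n \<Rightarrow> 'n \<Rightarrow> (real^'n \<Rightarrow> real) \<Rightarrow> real" where
  "G_variation V i j k \<phi> = (\<integral>(y, S). S $ j $ k * ((S *v gradient \<phi> y) \<bullet> axis i 1) \<partial>V)"

definition first_variation ::
    "((real^'n) \<times> (real^'n^'n)) measure \<Rightarrow> (real^'n \<Rightarrow> real) \<Rightarrow> real^'n" where
  "first_variation V \<phi> = (\<integral>(y, S). S *v gradient \<phi> y \<partial>V)"

definition bounded_variations ::
    "(real^'n) set \<Rightarrow> ((real^'n) \<times> (real^'n^'n)) measure \<Rightarrow> bool" where
  "bounded_variations \<Omega> V \<longleftrightarrow> (\<forall>i j k. is_signed_radon \<Omega> (G_variation V i j k))"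

definition beta ::
    "(real^'n) set \<Rightarrow> ((real^'n) \<times> (real^'n^'n)) measure \<Rightarrow> 'n \<Rightarrow> 'n \<Rightarrow> 'n \<Rightarrow> real^'n \<Rightarrow> real" where
  "beta \<Omega> V i j k x = - ac_density \<Omega> (mass \<Omega> V) (G_variation V i j k) x"

definition mean_curvature ::
    "(real^'n) set \<Rightarrow> ((real^'n) \<times> (real^'n^'n)) measure \<Rightarrow> real^'n \<Rightarrow> real^'n" where
  "mean_curvature \<Omega> V x =
     (\<chi> i. - ac_density \<Omega> (mass \<Omega> V) (\<lambda>\<phi>. first_variation V \<phi> $ i) x)"

definition mean_projection ::
    "(real^'n \<Rightarrow> (real^'n^'n) measure) \<Rightarrow> real^'n \<Rightarrow> real^'n^'n" where
  "mean_projection \<nu> x = (\<integral>S. S \<partial>\<nu> x)"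

text \<open>
  The weak second fundamental form. The linear system is uniquely solvable at almost every point;
  where it is not, the value is irrelevant.
\<close>

definition weak_sff ::
    "(real^'n) set \<Rightarrow> ((real^'n) \<times> (real^'n^'n)) measure \<Rightarrow> (real^'n \<Rightarrow> (real^'n^'n) measure)
      \<Rightarrow> 'n \<Rightarrow> 'n \<Rightarrow> 'n \<Rightarrow> real^'n \<Rightarrow> real" where
  "weak_sff \<Omega> V \<nu> i j k x =
     (THE a. \<forall>i j k. a i j k + mean_projection \<nu> x $ j $ k * (\<Sum>q\<in>UNIV. a q i q)
                    = beta \<Omega> V i j k x) i j k"

end

theory Submission
  imports Defs
begin

text \<open>
  A point \<open>S\<close> of the Grassmannian is a symmetric idempotent matrix of trace \<open>d\<close>. Inserted under the
  integrals that define the variations, these three facts give, in this order,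
  \<open>\<delta>\<^sub>i\<^sub>j\<^sub>k V = \<delta>\<^sub>i\<^sub>k\<^sub>j V\<close>, then \<open>(\<Sum>q. \<delta>\<^sub>q\<^sub>i\<^sub>q V) = (\<delta>V)\<^sub>i\<close>, and \<open>(\<Sum>q. \<delta>\<^sub>i\<^sub>q\<^sub>q V) = d (\<delta>V)\<^sub>i\<close>
  (lemmas \<open>G_variation_sym\<close>, \<open>G_variation_trace_outer\<close>, \<open>G_variation_trace_last\<close>).

  To pass from distributions to densities, the absolutely continuous part must depend linearly
  on the functional, up to null sets (\<open>ac_density_relation\<close>). This holds because a signed Radon measure
  is determined by its action on continuously differentiable functions with compact support
  (\<open>functional_vanishing_on_C1c\<close>) and because singular parts are carried by a null set. Existence of
  the densities is the Lebesgue decomposition (\<open>Lebesgue_decomposition_radon\<close>); for the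
  mean curvature one uses that \<open>\<delta>V\<close> is a sum of \<open>G\<close>-linear variations, hence again a signed Radon measure.

  The statement on \<open>A\<close> is then pointwise linear algebra. The matrix \<open>c\<close> is an average of
  projections, hence symmetric and positive semidefinite with trace \<open>d\<close>, and \<open>I + c\<close> is invertible.
  Contracting the system in its first and last index gives \<open>(I + c) t = H\<close> for
  \<open>t\<^sub>i = (\<Sum>q. A\<^sub>q\<^sub>i\<^sub>q)\<close>, so that \<open>A\<^sub>i\<^sub>j\<^sub>k = \<beta>\<^sub>i\<^sub>j\<^sub>k - c\<^sub>j\<^sub>k t\<^sub>i\<close>, from which all assertions follow
  (\<open>sff_system_solution\<close>).
\<close>

section \<open>Orthogonal projections and the Grassmannian\<close>

text \<open>
  The trace is computed in an orthonormal basis \<open>B\<close> of \<open>T\<close>: since \<open>S x = (\<Sum>b\<in>B. (x \<bullet> b) b)\<close>, the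
  diagonal entry \<open>S\<^sub>i\<^sub>i\<close> is the sum of the squared \<open>i\<close>-th coordinates of the basis vectors, so the trace
  counts the basis.
\<close>

lemma projection_matrix_properties:
  fixes S :: "real^'n^'n"
  assumes T: "subspace T" and S: "is_orthogonal_projection S T"
  shows "transpose S = S" and "S ** S = S" and "trace S = real (dim T)"
proof -
  have ST: "S *v x \<in> T" for x
    using S by (simp add: is_orthogonal_projection_def)
  have orth: "(x - S *v x) \<bullet> y = 0" if "y \<in> T" for x y
    using S that by (simp add: is_orthogonal_projection_def)
  have quad: "(S *v x) \<bullet> y = (S *v x) \<bullet> (S *v y)" for x y
    using orth[OF ST[of x], of y] by (simp add: inner_diff_left inner_diff_right inner_commute[of _ "S *v x"])
  have sym: "(S *v x) \<bullet> y = x \<bullet> (S *v y)" for x y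
    using quad[of x y] quad[of y x] by (simp add: inner_commute)
  have "(transpose S *v x) \<bullet> y = (S *v x) \<bullet> y" for x y
    by (simp only: transpose_matrix_vector dot_lmul_matrix sym)
  then have "transpose S *v x = S *v x" for x
    using vector_eq_rdot by blast
  then show "transpose S = S"
    by (simp add: matrix_eq)
  have fixed: "S *v y = y" if "y \<in> T" for y
  proof -
    have "y - S *v y \<in> T"
      using that ST T by (blast intro: subspace_diff)
    then show ?thesis
      using orth[of "y - S *v y" y] by simp
  qed
  have "(S ** S) *v x = S *v x" for x
    using fixed[OF ST] by (simp flip: matrix_vector_mul_assoc)
  then show "S ** S = S"
    by (simp add: matrix_eq)
  obtain B where B: "B \<subseteq> T" "pairwise orthogonal B" "\<And>x. x \<in> B \<Longrightarrow> norm x = 1"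
    "independent B" "card B = dim T" "span B = T"
    using orthonormal_basis_subspace[OF T] by metis
  have fin: "finite B"
    using B(4) by (rule independent_imp_finite)
  have onb: "b \<bullet> b' = (if b = b' then 1 else 0)" if "b \<in> B" "b' \<in> B" for b b'
    using B(2,3) that by (auto simp: pairwise_def orthogonal_def norm_eq_1)
  have expand: "S *v x = (\<Sum>b\<in>B. (x \<bullet> b) *\<^sub>R b)" for x
  proof -
    define p where "p = S *v x - (\<Sum>b\<in>B. (x \<bullet> b) *\<^sub>R b)"
    have pT: "p \<in> T"
      unfolding p_def using B(1) T ST by (intro subspace_diff subspace_sum subspace_scale) auto
    have "p \<bullet> b = 0" if b: "b \<in> B" for b
    proof -
      have "(S *v x) \<bullet> b = x \<bullet> b"
        using orth[of b x] B(1) b by (auto simp: inner_diff_left)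
      then show ?thesis
        using b fin by (simp add: p_def inner_diff_left inner_sum_left onb if_distrib sum.delta cong: if_cong)
    qed
    then have "orthogonal p p"
      using pT B(6) by (intro orthogonal_to_span[of p B]) (auto simp: orthogonal_def)
    then have "p = 0"
      by (simp add: orthogonal_def)
    then show ?thesis by (simp add: p_def)
  qed
  have diag: "S $ i $ i = (\<Sum>b\<in>B. (b $ i)\<^sup>2)" for i
  proof -
    have "S $ i $ i = (S *v axis i 1) $ i"
      by (simp add: matrix_vector_mul_component inner_axis)
    also have "\<dots> = (\<Sum>b\<in>B. (b $ i)\<^sup>2)"
      by (simp add: expand inner_axis' power2_eq_square)
    finally show ?thesis .
  qed
  have "trace S = (\<Sum>b\<in>B. \<Sum>i\<in>UNIV. (b $ i)\<^sup>2)"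
    unfolding trace_def diag by (rule sum.swap)
  also have "\<dots> = (\<Sum>b\<in>B. 1)"
    using onb by (intro sum.cong) (auto simp: inner_vec_def power2_eq_square)
  finally show "trace S = real (dim T)"
    by (simp add: B(5))
qed

text \<open>
  This description by polynomial equations in the entries makes compactness evident, and it contains
  everything about projections that the varifold identities use.
\<close>

lemma grassmannian_iff:
  fixes S :: "real^'n^'n"
  shows "S \<in> grassmannian d \<longleftrightarrow> transpose S = S \<and> S ** S = S \<and> trace S = real d"
proof
  assume "S \<in> grassmannian d"
  then show "transpose S = S \<and> S ** S = S \<and> trace S = real d"
    using projection_matrix_properties by (fastforce simp: grassmannian_def)
next
  assume S: "transpose S = S \<and> S ** S = S \<and> trace S = real d"
  let ?T = "range ((*v) S)"
  have T: "subspace ?T"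
    by (simp add: linear_subspace_image)
  have "(x - S *v x) \<bullet> (S *v z) = 0" for x z
  proof -
    have "(x - S *v x) \<bullet> (S *v z) = (S *v (x - S *v x)) \<bullet> z"
      using S by (metis dot_lmul_matrix vector_transpose_matrix)
    also have "S *v (x - S *v x) = 0"
      using S by (simp add: matrix_vector_mult_diff_distrib matrix_vector_mul_assoc)
    finally show ?thesis by simp
  qed
  then have proj: "is_orthogonal_projection S ?T"
    by (auto simp: is_orthogonal_projection_def)
  have "dim ?T = d"
    using projection_matrix_properties(3)[OF T proj] S by simp
  then show "S \<in> grassmannian d"
    using T proj by (auto simp: grassmannian_def)
qed

text \<open>
  Boundedness holds because the squared Frobenius norm of a symmetric idempotent matrix is its trace.
\<close>

lemma compact_grassmannian: "compact (grassmannian d :: (real^'n^'n) set)"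
proof -
  have eq: "(grassmannian d :: (real^'n^'n) set) =
      {S. (\<forall>i j. S $ j $ i = S $ i $ j) \<and> (\<forall>i j. (\<Sum>k\<in>UNIV. S $ i $ k * S $ k $ j) = S $ i $ j) \<and>
          (\<Sum>i\<in>UNIV. S $ i $ i) = real d}"
    by (auto simp: grassmannian_iff vec_eq_iff transpose_def matrix_matrix_mult_def trace_def)
  have "closed (grassmannian d :: (real^'n^'n) set)"
    unfolding eq
    by (intro closed_Collect_conj closed_Collect_all closed_Collect_eq continuous_intros)
  moreover have "norm S \<le> sqrt (real d)" if "S \<in> grassmannian d" for S :: "real^'n^'n"
  proof -
    have "S $ k $ i = S $ i $ k" for i k
      using that unfolding eq by blast
    then have "S \<bullet> S = (\<Sum>i\<in>UNIV. \<Sum>k\<in>UNIV. S $ i $ k * S $ k $ i)"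
      by (simp add: inner_vec_def)
    also have "\<dots> = (\<Sum>i\<in>UNIV. S $ i $ i)"
      using that unfolding eq by (intro sum.cong) blast+
    also have "\<dots> = real d"
      using that unfolding eq by blast
    finally show ?thesis
      by (simp add: norm_eq_sqrt_inner)
  qed
  then have "bounded (grassmannian d :: (real^'n^'n) set)"
    by (auto simp: bounded_iff)
  ultimately show ?thesis
    by (simp add: compact_eq_bounded_closed)
qed

text \<open>
  Symmetry, trace \<open>d\<close> and positive semidefiniteness are cut out by linear equations and inequalities
  in the matrix, so they pass from the projections to their average. The average itself is
  in general not a projection.
\<close>

lemma mean_projection_properties:
  fixes \<nu> :: "real^'n \<Rightarrow> (real^'n^'n) measure"
  assumes "prob_space (\<nu> x)"
    and sets: "sets (\<nu> x) = sets (restrict_space borel (grassmannian d))"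
  defines "c \<equiv> mean_projection \<nu> x"
  shows "transpose c = c" and "trace c = real d" and "0 \<le> y \<bullet> (c *v y)"
proof -
  interpret prob_space "\<nu> x" by fact
  have space: "space (\<nu> x) = grassmannian d"
    using sets_eq_imp_space_eq[OF sets] by (simp add: space_restrict_space)
  have meas: "(\<lambda>S. S) \<in> borel_measurable (\<nu> x)"
    using sets by (simp add: measurable_restrict_space1 cong: measurable_cong_sets)
  obtain B where B: "\<And>S :: real^'n^'n. S \<in> grassmannian d \<Longrightarrow> norm S \<le> B"
    using compact_imp_bounded[OF compact_grassmannian[of d]] unfolding bounded_iff by blast
  have int: "integrable (\<nu> x) (\<lambda>S. S)"
    by (rule integrable_const_bound[where B=B]) (use meas B space in \<open>auto intro!: AE_I2\<close>)
  have lin: "T c = (\<integral>S. T S \<partial>\<nu> x)" if "bounded_linear T" for T :: "real^'n^'n \<Rightarrow> real"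
    unfolding c_def mean_projection_def by (rule integral_bounded_linear[OF that int, symmetric])
  have entry: "bounded_linear (\<lambda>S :: real^'n^'n. S $ i $ j)" for i j
    by (intro bounded_linear_compose[OF bounded_linear_vec_nth bounded_linear_vec_nth])
  have "c $ j $ i = c $ i $ j" for i j
    unfolding lin[OF entry]
    by (rule Bochner_Integration.integral_cong)
       (auto simp: space grassmannian_iff transpose_def vec_eq_iff)
  then show "transpose c = c"
    by (simp add: transpose_def vec_eq_iff)
  have tr: "bounded_linear (trace :: real^'n^'n \<Rightarrow> real)"
    unfolding trace_def by (intro bounded_linear_sum entry)
  have "trace c = (\<integral>S. real d \<partial>\<nu> x)"
    unfolding lin[OF tr] by (rule Bochner_Integration.integral_cong) (auto simp: space grassmannian_iff)
  then show "trace c = real d"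
    by (simp add: prob_space)
  have quad: "bounded_linear (\<lambda>S :: real^'n^'n. y \<bullet> (S *v y))"
    unfolding inner_vec_def matrix_vector_mult_def
    by (auto intro!: bounded_linear_sum bounded_linear_const_mult bounded_linear_mult_const entry)
  have "0 \<le> y \<bullet> (S *v y)" if "S \<in> grassmannian d" for S
  proof -
    have "transpose S = S" "S ** S = S"
      using that by (auto simp: grassmannian_iff)
    then have "y \<bullet> (S *v y) = (S *v y) \<bullet> (S *v y)"
      by (metis dot_lmul_matrix matrix_vector_mul_assoc vector_transpose_matrix)
    then show ?thesis by simp
  qed
  then show "0 \<le> y \<bullet> (c *v y)"
    unfolding lin[OF quad] by (intro integral_nonneg_AE AE_I2) (simp add: space)
qed

section \<open>The linear system of the weak second fundamental form\<close>

lemma invertible_one_plus_psd: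
  fixes c :: "real^'n^'n"
  assumes psd: "\<And>y. 0 \<le> y \<bullet> (c *v y)"
  shows "invertible (mat 1 + c)"
proof -
  have "y = 0" if "(mat 1 + c) *v y = 0" for y
  proof -
    have "y \<bullet> y + y \<bullet> (c *v y) = y \<bullet> ((mat 1 + c) *v y)"
      by (simp add: matrix_vector_mult_add_rdistrib inner_add_right)
    then have "y \<bullet> y \<le> 0"
      using psd[of y] that by simp
    then show ?thesis
      by (metis inner_ge_zero inner_eq_zero_iff order_antisym)
  qed
  then show ?thesis
    by (meson invertible_left_inverse matrix_left_invertible_ker)
qed

text \<open>
  Write \<open>t\<^sub>i = (\<Sum>q. a\<^sub>q\<^sub>i\<^sub>q)\<close>. Summing the equations with index pattern \<open>qiq\<close> gives \<open>(I + c) t = h\<close>, so the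
  trace \<open>t\<close> is determined by the data, and then the system reads \<open>a\<^sub>i\<^sub>j\<^sub>k = b\<^sub>i\<^sub>j\<^sub>k - c\<^sub>j\<^sub>k t\<^sub>i\<close>. The symmetry of
  \<open>a\<close> and the value of the trace over the last two indices, namely \<open>d (h - t) = d c t\<close>, are read off
  from this formula.
\<close>

lemma sff_system_solution:
  fixes c :: "real^'n^'n" and b :: "'n \<Rightarrow> 'n \<Rightarrow> 'n \<Rightarrow> real" and h :: "real^'n" and d :: real
  assumes inv: "invertible (mat 1 + c)"
    and sym_c: "transpose c = c" and tr_c: "trace c = d"
    and sym_b: "\<And>i j k. b i j k = b i k j"
    and b_h: "\<And>i. (\<Sum>q\<in>UNIV. b q i q) = h $ i"
    and b_dh: "\<And>i. (\<Sum>q\<in>UNIV. b i q q) = d * h $ i"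
  defines "a \<equiv> (THE a. \<forall>i j k. a i j k + c $ j $ k * (\<Sum>q\<in>UNIV. a q i q) = b i j k)"
  shows "a i j k = a i k j"
    and "(\<chi> i. \<Sum>q\<in>UNIV. a q i q) = matrix_inv (mat 1 + c) *v h"
    and "(\<chi> i. \<Sum>q\<in>UNIV. a i q q) = d *\<^sub>R (c *v (matrix_inv (mat 1 + c) *v h))"
proof -
  define t where "t = matrix_inv (mat 1 + c) *v h"
  have c_sym: "c $ i $ j = c $ j $ i" for i j
    using sym_c by (simp add: transpose_def vec_eq_iff)
  have inv_r: "(mat 1 + c) ** matrix_inv (mat 1 + c) = mat 1"
    and inv_l: "matrix_inv (mat 1 + c) ** (mat 1 + c) = mat 1"
    using inv unfolding invertible_def matrix_inv_def by (metis (mono_tags, lifting) someI_ex)+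
  have "(mat 1 + c) *v t = h"
    by (simp add: t_def matrix_vector_mul_assoc inv_r)
  then have h_t: "h = t + c *v t"
    by (simp add: matrix_vector_mult_add_rdistrib)
  define a' where "a' i j k = b i j k - c $ j $ k * t $ i" for i j k
  have trace_a': "(\<Sum>q\<in>UNIV. a' q i q) = t $ i" for i
  proof -
    have "(\<Sum>q\<in>UNIV. a' q i q) = h $ i - (c *v t) $ i"
      by (simp add: a'_def sum_subtractf b_h matrix_vector_mult_def)
    then show ?thesis by (simp add: h_t)
  qed
  \<comment> \<open>the candidate \<open>a'\<close> solves the system because its own trace is the \<open>t\<close> used to define it\<close>
  have "a = a'"
    unfolding a_def
  proof (rule the_equality)
    show "\<forall>i j k. a' i j k + c $ j $ k * (\<Sum>q\<in>UNIV. a' q i q) = b i j k"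
      unfolding trace_a' by (simp add: a'_def)
  next
    fix u assume u: "\<forall>i j k. u i j k + c $ j $ k * (\<Sum>q\<in>UNIV. u q i q) = b i j k"
    define s where "s = (\<chi> i. \<Sum>q\<in>UNIV. u q i q)"
    have u_s: "u i j k + c $ j $ k * s $ i = b i j k" for i j k
      using u by (simp add: s_def)
    \<comment> \<open>contracting the first index with the last turns the system into a linear equation for the trace\<close>
    have "(\<Sum>q\<in>UNIV. u q i q + c $ i $ q * s $ q) = h $ i" for i
      unfolding u_s by (rule b_h)
    then have "(mat 1 + c) *v s = h"
      by (simp add: matrix_vector_mult_add_rdistrib vec_eq_iff sum.distrib)
         (simp add: s_def matrix_vector_mult_def)
    then have "s = t"
      unfolding t_def using inv_l by (metis matrix_vector_mul_assoc matrix_vector_mul_lid)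
    then show "u = a'"
      using u_s by (intro ext) (simp add: a'_def algebra_simps)
  qed
  show "a i j k = a i k j"
    unfolding \<open>a = a'\<close> a'_def using sym_b[of i j k] c_sym[of j k] by simp
  show "(\<chi> i. \<Sum>q\<in>UNIV. a q i q) = matrix_inv (mat 1 + c) *v h"
    unfolding \<open>a = a'\<close> trace_a' by (simp add: t_def)
  have "(\<Sum>q\<in>UNIV. a' i q q) = d * (h $ i - t $ i)" for i
    using tr_c by (simp add: a'_def sum_subtractf b_dh trace_def right_diff_distrib flip: sum_distrib_right)
  then show "(\<chi> i. \<Sum>q\<in>UNIV. a i q q) = d *\<^sub>R (c *v (matrix_inv (mat 1 + c) *v h))"
    unfolding \<open>a = a'\<close> t_def[symmetric] by (simp add: vec_eq_iff h_t)
qed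

section \<open>Radon measures and their Lebesgue decomposition\<close>

lemma radon_measure_onD:
  assumes "radon_measure_on X M"
  shows "sets M = sets (restrict_space borel X)" and "space M = X"
    and "\<And>K. compact K \<Longrightarrow> K \<subseteq> X \<Longrightarrow> emeasure M K < \<infinity>"
  using assms sets_eq_imp_space_eq[of M "restrict_space borel X"]
  by (auto simp: radon_measure_on_def space_restrict_space)

lemma sets_radonI:
  assumes "radon_measure_on X M" "A \<in> sets borel" "A \<subseteq> X"
  shows "A \<in> sets M"
  unfolding radon_measure_onD(1)[OF assms(1)] sets_restrict_space
  using assms(2,3) by (intro image_eqI[of _ _ A]) auto

lemma borel_measurable_radonI:
  fixes f :: "'a::topological_space \<Rightarrow> 'b::topological_space"
  assumes "radon_measure_on X M" "f \<in> borel_measurable borel"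
  shows "f \<in> borel_measurable M"
  using measurable_restrict_space1[OF assms(2), of X] radon_measure_onD(1)[OF assms(1)]
  by (simp cong: measurable_cong_sets)

lemma sigma_finite_radon:
  fixes \<Omega> :: "'a::euclidean_space set"
  assumes "open \<Omega>" and M: "radon_measure_on \<Omega> M"
  shows "sigma_finite_measure M"
proof -
  obtain C :: "nat \<Rightarrow> 'a set" where C: "\<And>n. compact (C n)" "\<And>n. C n \<subseteq> \<Omega>" "\<Union>(range C) = \<Omega>"
    using open_Union_compact_subsets[OF assms(1)] by metis
  show ?thesis
  proof (rule sigma_finite_measure.intro, intro exI conjI ballI)
    show "range C \<subseteq> sets M"
      using C(1,2) by (auto intro!: sets_radonI[OF M] borel_compact)
  qed (use C radon_measure_onD[OF M] in \<open>auto simp: less_top\<close>)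
qed

lemma radon_dominated:
  assumes "radon_measure_on X M" "sets N = sets M"
    and "\<And>A. A \<in> sets M \<Longrightarrow> emeasure N A \<le> emeasure M A"
  shows "radon_measure_on X N"
  using assms unfolding radon_measure_on_def
  by (metis emeasure_notin_sets le_less_trans ennreal_zero_less_top infinity_ennreal_def)

text \<open>
  Sums of measures are needed twice: to find a null set of \<open>M\<close> that carries the singular part of a
  second measure, and to see that sums of signed Radon measures are signed Radon measures.
\<close>

definition measure_plus :: "'a measure \<Rightarrow> 'a measure \<Rightarrow> 'a measure" where
  "measure_plus M N = measure_of (space M) (sets M) (\<lambda>A. emeasure M A + emeasure N A)"

lemma sets_measure_plus [simp, measurable_cong]: "sets (measure_plus M N) = sets M"
  and space_measure_plus [simp]: "space (measure_plus M N) = space M"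
  by (simp_all add: measure_plus_def)

lemma emeasure_measure_plus:
  assumes "sets N = sets M" "A \<in> sets M"
  shows "emeasure (measure_plus M N) A = emeasure M A + emeasure N A"
  unfolding measure_plus_def
proof (rule emeasure_measure_of_sigma)
  show "countably_additive (sets M) (\<lambda>A. emeasure M A + emeasure N A)"
    using assms(1) by (auto simp: countably_additive_def suminf_add[symmetric] suminf_emeasure)
qed (auto simp: positive_def assms sets.sigma_algebra_axioms)

lemma nn_integral_measure_plus:
  assumes sets: "sets N = sets M" and f: "f \<in> borel_measurable M"
  shows "(\<integral>\<^sup>+x. f x \<partial>measure_plus M N) = (\<integral>\<^sup>+x. f x \<partial>M) + (\<integral>\<^sup>+x. f x \<partial>N)"
  using f
proof (induction rule: borel_measurable_induct)
  case (cong f g)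
  then show ?case
    using sets_eq_imp_space_eq[OF sets] by (simp cong: nn_integral_cong_simp)
next
  case (set A)
  then show ?case
    using sets by (simp add: emeasure_measure_plus)
next
  case (mult u c)
  then show ?case
    using sets by (simp add: nn_integral_cmult distrib_left cong: measurable_cong_sets)
next
  case (add u v)
  then show ?case
    using sets by (simp add: nn_integral_add ac_simps cong: measurable_cong_sets)
next
  case (seq U)
  have meas: "U i \<in> borel_measurable N" "U i \<in> borel_measurable (measure_plus M N)" for i
    using seq(1) sets by (simp_all cong: measurable_cong_sets)
  have inc: "incseq (\<lambda>i. integral\<^sup>N M (U i))" "incseq (\<lambda>i. integral\<^sup>N N (U i))"
    using seq(3) by (auto simp: incseq_def le_fun_def intro!: nn_integral_mono)
  show ?case
    using seq meas
    by (simp add: image_comp nn_integral_monotone_convergence_SUP inc ennreal_SUP_add)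
qed

lemma integral_measure_plus:
  fixes f :: "'a \<Rightarrow> real"
  assumes sets: "sets N = sets M" and M: "integrable M f" and N: "integrable N f"
  shows "(\<integral>x. f x \<partial>measure_plus M N) = (\<integral>x. f x \<partial>M) + (\<integral>x. f x \<partial>N)"
proof -
  have [measurable]: "f \<in> borel_measurable M" "f \<in> borel_measurable N"
    using M N by auto
  have nn: "(\<integral>\<^sup>+x. ennreal (g x) \<partial>measure_plus M N) = (\<integral>\<^sup>+x. ennreal (g x) \<partial>M) + (\<integral>\<^sup>+x. ennreal (g x) \<partial>N)"
    if "g \<in> borel_measurable M" for g :: "'a \<Rightarrow> real"
    using that by (intro nn_integral_measure_plus sets) measurable
  have "integrable (measure_plus M N) f"
    using M N unfolding integrable_iff_bounded by (auto simp: nn)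
  then show "(\<integral>x. f x \<partial>measure_plus M N) = (\<integral>x. f x \<partial>M) + (\<integral>x. f x \<partial>N)"
    using M N by (simp add: real_lebesgue_integral_def nn real_integrable_def enn2real_plus less_top)
qed

lemma radon_measure_plus:
  assumes "radon_measure_on X M" "radon_measure_on X N"
  shows "radon_measure_on X (measure_plus M N)"
proof -
  have sets: "sets N = sets M"
    using assms by (simp add: radon_measure_on_def)
  have "emeasure (measure_plus M N) K < \<infinity>" if "compact K" "K \<subseteq> X" for K
  proof (cases "K \<in> sets M")
    case True
    then show ?thesis
      using radon_measure_onD(3)[OF assms(1) that] radon_measure_onD(3)[OF assms(2) that]
      by (simp add: emeasure_measure_plus sets)
  qed (simp add: emeasure_notin_sets)
  then show ?thesis
    using assms(1) by (simp add: radon_measure_on_def)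
qed

lemma L1_locI:
  assumes "f \<in> borel_measurable M" "\<And>K. compact K \<Longrightarrow> K \<subseteq> \<Omega> \<Longrightarrow> set_integrable M K f"
  shows "f \<in> L1_loc \<Omega> M"
  using assms by (auto simp: L1_loc_def)

text \<open>
  A locally integrable function may be tested against any bounded Borel function with compact support.
\<close>

lemma integrable_L1_loc_mult:
  assumes M: "radon_measure_on \<Omega> M" and f: "f \<in> L1_loc \<Omega> M" and K: "compact K" "K \<subseteq> \<Omega>"
    and u: "u \<in> borel_measurable M" "\<And>x. x \<in> \<Omega> \<Longrightarrow> \<bar>u x\<bar> \<le> B * indicator K x"
  shows "integrable M (\<lambda>x. f x * u x)"
proof (rule Bochner_Integration.integrable_bound)
  show "integrable M (\<lambda>x. B * (indicator K x * f x))"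
    using f K by (auto simp: L1_loc_def set_integrable_def)
  show "(\<lambda>x. f x * u x) \<in> borel_measurable M"
    using f u(1) by (auto simp: L1_loc_def)
  have "\<bar>f x * u x\<bar> \<le> \<bar>B * (indicator K x * f x)\<bar>" if "x \<in> \<Omega>" for x
  proof -
    have "\<bar>u x\<bar> \<le> \<bar>B\<bar> * indicator K x"
      using u(2)[OF that] by (cases "x \<in> K") auto
    then show ?thesis
      using mult_left_mono[of "\<bar>u x\<bar>" "\<bar>B\<bar> * indicator K x" "\<bar>f x\<bar>"]
      by (simp add: abs_mult ac_simps)
  qed
  then show "AE x in M. norm (f x * u x) \<le> norm (B * (indicator K x * f x))"
    using radon_measure_onD(2)[OF M] by (auto intro!: AE_I2)
qed

text \<open>
  With this fact, integrals of test functions against a Radon measure become a special case of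
  integrals against a locally integrable density.
\<close>

lemma one_L1_loc:
  fixes \<Omega> :: "'a::t2_space set"
  assumes M: "radon_measure_on \<Omega> M"
  shows "(\<lambda>x. 1) \<in> L1_loc \<Omega> M"
proof (rule L1_locI)
  fix K assume "compact K" "K \<subseteq> \<Omega>"
  then show "set_integrable M K (\<lambda>x. 1::real)"
    using sets_radonI[OF M borel_compact] radon_measure_onD(3)[OF M, of K]
    by (auto simp: set_integrable_def integrable_indicator_iff)
qed simp

lemma L1_loc_add:
  assumes "f \<in> L1_loc \<Omega> M" "g \<in> L1_loc \<Omega> M"
  shows "(\<lambda>x. f x + g x) \<in> L1_loc \<Omega> M"
  using assms by (auto simp: L1_loc_def intro!: set_integral_add)

lemma L1_loc_cmult:
  assumes "f \<in> L1_loc \<Omega> M"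
  shows "(\<lambda>x. c * f x) \<in> L1_loc \<Omega> M"
  using assms by (auto simp: L1_loc_def)

lemma L1_loc_sum:
  assumes "\<And>i. i \<in> I \<Longrightarrow> f i \<in> L1_loc \<Omega> M"
  shows "(\<lambda>x. \<Sum>i\<in>I. f i x) \<in> L1_loc \<Omega> M"
  using assms
proof (induction I rule: infinite_finite_induct)
  case (insert i I)
  then show ?case
    by (simp add: L1_loc_add)
qed (auto simp: L1_loc_def set_integrable_def)

text \<open>
  The measure \<open>M\<close> has a density \<open>r\<close> with respect to \<open>P = M + \<sigma>\<close>. The set \<open>N\<close> of zeros of \<open>r\<close> is null for
  \<open>M\<close>, so \<open>\<sigma>\<close> restricted to \<open>N\<close> is singular. Off \<open>N\<close> the density is positive, so \<open>M\<close>-null sets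
  outside \<open>N\<close> are \<open>P\<close>-null, and \<open>\<sigma>\<close> restricted to the complement of \<open>N\<close> has a Radon--Nikodym density \<open>h\<close>, which is
  locally integrable because \<open>\<sigma>\<close> is finite on compact sets.
\<close>

lemma Lebesgue_decomposition_radon:
  fixes \<Omega> :: "'a::euclidean_space set"
  assumes "open \<Omega>" and M: "radon_measure_on \<Omega> M" and \<sigma>: "radon_measure_on \<Omega> \<sigma>"
  obtains h \<sigma>s where "h \<in> L1_loc \<Omega> M" "radon_measure_on \<Omega> \<sigma>s" "singular_wrt \<sigma>s M"
    "\<And>u :: 'a \<Rightarrow> real. integrable \<sigma> u \<Longrightarrow> (\<integral>x. u x \<partial>\<sigma>) = (\<integral>x. h x * u x \<partial>M) + (\<integral>x. u x \<partial>\<sigma>s)"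
proof -
  define P where "P = measure_plus M \<sigma>"
  interpret M: sigma_finite_measure M
    using sigma_finite_radon[OF assms(1) M] .
  interpret P: sigma_finite_measure P
    unfolding P_def by (rule sigma_finite_radon[OF assms(1) radon_measure_plus[OF M \<sigma>]])
  have sets_\<sigma>: "sets \<sigma> = sets M"
    using M \<sigma> by (simp add: radon_measure_on_def)
  have sets_P [simp]: "sets P = sets M"
    by (simp add: P_def)
  have eP: "emeasure P A = emeasure M A + emeasure \<sigma> A" if "A \<in> sets M" for A
    using that by (simp add: P_def emeasure_measure_plus sets_\<sigma>)
  define r where "r = RN_deriv P M"
  have r_meas [measurable]: "r \<in> borel_measurable M"
    using borel_measurable_RN_deriv[of P M] by (simp add: r_def cong: measurable_cong_sets)
  have r_meas_P [measurable]: "r \<in> borel_measurable P"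
    by (simp add: r_def)
  have "absolutely_continuous P M"
    by (auto simp: absolutely_continuous_def null_sets_def eP)
  then have dens_r: "density P r = M"
    unfolding r_def by (rule P.density_RN_deriv) simp
  define N where "N = {x\<in>space M. r x = 0}"
  have N [measurable]: "N \<in> sets M"
    unfolding N_def by measurable
  have null_iff: "emeasure M A = 0 \<longleftrightarrow> (AE x in P. x \<in> A \<longrightarrow> r x = 0)" if "A \<in> sets M" for A
  proof -
    have "emeasure M A = (\<integral>\<^sup>+x. r x * indicator A x \<partial>P)"
      using that by (subst dens_r[symmetric]) (simp add: emeasure_density)
    also have "\<dots> = 0 \<longleftrightarrow> (AE x in P. r x * indicator A x = 0)"
    proof (rule nn_integral_0_iff_AE)
      have [measurable]: "A \<in> sets P" using that by simp
      show "(\<lambda>x. r x * indicator A x) \<in> borel_measurable P" by measurable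
    qed
    finally show ?thesis
      by (auto simp: indicator_def of_bool_def elim!: AE_mp intro!: AE_I2 split: if_splits)
  qed
  have MN: "emeasure M N = 0"
    unfolding null_iff[OF N] by (simp add: N_def)
  define \<sigma>a where "\<sigma>a = density \<sigma> (indicator (space M - N))"
  define \<sigma>s where "\<sigma>s = density \<sigma> (indicator N)"
  have sets_\<sigma>a: "sets \<sigma>a = sets M" and sets_\<sigma>s: "sets \<sigma>s = sets M"
    by (simp_all add: \<sigma>a_def \<sigma>s_def sets_\<sigma>)
  have e\<sigma>a: "emeasure \<sigma>a A = emeasure \<sigma> ((space M - N) \<inter> A)"
    and e\<sigma>s: "emeasure \<sigma>s A = emeasure \<sigma> (N \<inter> A)" if "A \<in> sets M" for A
    using that N emeasure_restricted[of "space M - N" \<sigma> A] emeasure_restricted[of N \<sigma> A]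
    by (simp_all add: \<sigma>a_def \<sigma>s_def sets_\<sigma>)
  have "absolutely_continuous M \<sigma>a"
    unfolding absolutely_continuous_def
  proof
    fix A assume "A \<in> null_sets M"
    then have A: "A \<in> sets M" "emeasure M A = 0" by auto
    then have "AE x in P. x \<in> A \<longrightarrow> r x = 0"
      using null_iff by simp
    then have "AE x in P. x \<notin> (space M - N) \<inter> A"
      by (rule AE_mp) (auto intro!: AE_I2 simp: N_def)
    then have "emeasure P ((space M - N) \<inter> A) = 0"
      using A N by (subst (asm) AE_iff_null_sets[symmetric]) auto
    then have "emeasure \<sigma> ((space M - N) \<inter> A) = 0"
      using A N by (simp add: eP)
    then show "A \<in> null_sets \<sigma>a"
      using A by (auto simp: e\<sigma>a sets_\<sigma>a)
  qed
  note ac = this sets_\<sigma>a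
  have rad_a: "radon_measure_on \<Omega> \<sigma>a" and rad_s: "radon_measure_on \<Omega> \<sigma>s"
    using N by (auto intro!: radon_dominated[OF \<sigma>] emeasure_mono simp: sets_\<sigma>a sets_\<sigma>s sets_\<sigma> e\<sigma>a e\<sigma>s)
  define h where "h x = enn2real (RN_deriv M \<sigma>a x)" for x
  have h_meas [measurable]: "h \<in> borel_measurable M"
    unfolding h_def by measurable
  have fin: "AE x in M. RN_deriv M \<sigma>a x = ennreal (h x)"
    using M.RN_deriv_finite[OF sigma_finite_radon[OF assms(1) rad_a] ac]
    by (rule AE_mp) (auto intro!: AE_I2 simp: h_def less_top)
  have "density M (\<lambda>x. ennreal (h x)) = density M (RN_deriv M \<sigma>a)"
    using fin by (intro density_cong) auto
  also have "\<dots> = \<sigma>a"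
    by (rule M.density_RN_deriv[OF ac])
  finally have dens_h: "density M (\<lambda>x. ennreal (h x)) = \<sigma>a" .
  have h_nn: "0 \<le> h x" for x
    by (simp add: h_def)
  have "h \<in> L1_loc \<Omega> M"
  proof (rule L1_locI)
    fix K assume K: "compact K" "K \<subseteq> \<Omega>"
    have "integrable \<sigma>a (indicator K :: 'a \<Rightarrow> real)"
      using one_L1_loc[OF rad_a] K by (auto simp: L1_loc_def set_integrable_def)
    then show "set_integrable M K h"
      using h_nn sets_radonI[OF M borel_compact[OF K(1)] K(2)]
      by (simp add: dens_h[symmetric] integrable_density set_integrable_def mult.commute)
  qed simp
  moreover have "singular_wrt \<sigma>s M"
    unfolding singular_wrt_def
  proof (intro bexI conjI)
    have "N \<inter> (space M - N) = {}" by auto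
    then show "emeasure \<sigma>s (space M - N) = 0"
      using N by (simp add: e\<sigma>s)
  qed (use N MN in auto)
  moreover have "(\<integral>x. u x \<partial>\<sigma>) = (\<integral>x. h x * u x \<partial>M) + (\<integral>x. u x \<partial>\<sigma>s)" if u: "integrable \<sigma> u"
    for u :: "'a \<Rightarrow> real"
  proof -
    have N\<sigma>: "N \<in> sets \<sigma>" "space M - N \<in> sets \<sigma>"
      using N by (auto simp: sets_\<sigma>)
    have u_meas: "u \<in> borel_measurable \<sigma>" "u \<in> borel_measurable M"
      using borel_measurable_integrable[OF u] sets_\<sigma> by (simp_all cong: measurable_cong_sets)
    have "(\<integral>x. u x \<partial>\<sigma>) = (\<integral>x. indicator (space M - N) x * u x + indicator N x * u x \<partial>\<sigma>)"
      using sets_eq_imp_space_eq[OF sets_\<sigma>]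
      by (intro Bochner_Integration.integral_cong) (auto simp: indicator_def)
    also have "\<dots> = (\<integral>x. indicator (space M - N) x * u x \<partial>\<sigma>) + (\<integral>x. indicator N x * u x \<partial>\<sigma>)"
      using integrable_mult_indicator[OF N\<sigma>(1) u] integrable_mult_indicator[OF N\<sigma>(2) u]
      by (intro Bochner_Integration.integral_add) simp_all
    also have "(\<integral>x. indicator N x * u x \<partial>\<sigma>) = (\<integral>x. u x \<partial>\<sigma>s)"
      using N\<sigma> u_meas integral_density[of u \<sigma> "indicator N"]
      by (simp add: \<sigma>s_def ennreal_indicator)
    also have "(\<integral>x. indicator (space M - N) x * u x \<partial>\<sigma>) = (\<integral>x. u x \<partial>\<sigma>a)"
      using N\<sigma> u_meas integral_density[of u \<sigma> "indicator (space M - N)"]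
      by (simp add: \<sigma>a_def ennreal_indicator)
    also have "\<dots> = (\<integral>x. h x * u x \<partial>M)"
      using u_meas h_nn by (simp add: dens_h[symmetric] integral_density)
    finally show ?thesis .
  qed
  ultimately show thesis
    using that rad_s by blast
qed

section \<open>Test functions and the measures that they determine\<close>

lemma gradient_eq:
  assumes "GDERIV \<phi> x :> D"
  shows "gradient \<phi> x = D"
  unfolding gradient_def
proof (rule the_equality)
  show "GDERIV \<phi> x :> D" by (rule assms)
next
  fix D' assume "GDERIV \<phi> x :> D'"
  then have "(\<lambda>h. h \<bullet> D') = (\<lambda>h. h \<bullet> D)"
    using assms unfolding gderiv_def by (rule has_derivative_unique)
  then show "D' = D"
    by (metis vector_eq_ldot)
qed

lemma GDERIV_gradient:
  fixes \<phi> :: "'a::euclidean_space \<Rightarrow> real"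
  assumes "\<phi> differentiable at x"
  shows "GDERIV \<phi> x :> gradient \<phi> x"
proof -
  obtain f' where f': "(\<phi> has_derivative f') (at x)"
    using assms by (auto simp: differentiable_def)
  have "f' = (\<lambda>h. h \<bullet> adjoint f' 1)"
    using adjoint_works[OF has_derivative_linear[OF f']] by auto
  then have "GDERIV \<phi> x :> adjoint f' 1"
    using f' unfolding gderiv_def by metis
  then show ?thesis
    using gradient_eq by metis
qed

lemma C1cI:
  fixes \<phi> :: "'a::euclidean_space \<Rightarrow> real"
  assumes D: "\<And>x. GDERIV \<phi> x :> D x" and cont: "continuous_on UNIV D"
    and K: "compact K" "K \<subseteq> \<Omega>" and supp: "\<And>x. x \<notin> K \<Longrightarrow> \<phi> x = 0"
  shows "\<phi> \<in> C1c \<Omega>"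
proof -
  have "gradient \<phi> = D"
    using gradient_eq[OF D] by blast
  have closure: "closure {x. \<phi> x \<noteq> 0} \<subseteq> K"
    using K(1) supp by (intro closure_minimal) (auto intro: compact_imp_closed)
  then have "compact (closure {x. \<phi> x \<noteq> 0})"
    using K(1) by (meson bounded_subset closed_closure compact_eq_bounded_closed)
  moreover have "\<phi> differentiable_on UNIV"
    using D by (auto simp: differentiable_on_def differentiable_def gderiv_def)
  ultimately show ?thesis
    using cont closure K(2) \<open>gradient \<phi> = D\<close> by (auto simp: C1c_def)
qed

lemma C1cE:
  fixes \<phi> :: "'a::euclidean_space \<Rightarrow> real"
  assumes "\<phi> \<in> C1c \<Omega>"
  obtains K where "compact K" "K \<subseteq> \<Omega>" "\<And>x. x \<notin> K \<Longrightarrow> \<phi> x = 0" "\<And>x. x \<notin> K \<Longrightarrow> gradient \<phi> x = 0"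
    "continuous_on UNIV \<phi>" "continuous_on UNIV (gradient \<phi>)" "\<And>x. GDERIV \<phi> x :> gradient \<phi> x"
proof -
  define K where "K = closure {x. \<phi> x \<noteq> 0}"
  have K: "compact K" "K \<subseteq> \<Omega>" "continuous_on UNIV (gradient \<phi>)"
    using assms by (auto simp: C1c_def K_def)
  have zero: "\<phi> x = 0" if "x \<notin> K" for x
    using that closure_subset[of "{x. \<phi> x \<noteq> 0}"] unfolding K_def by blast
  have grad_zero: "gradient \<phi> x = 0" if "x \<notin> K" for x
  proof (rule gradient_eq)
    have "((\<lambda>x. 0) has_derivative (\<lambda>h. h \<bullet> 0)) (at x)"
      by simp
    then show "GDERIV \<phi> x :> 0"
      unfolding gderiv_def
    proof (rule has_derivative_transform_within_open)
      show "open (- K)"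
        by (simp add: K_def open_Compl)
    qed (use that zero in auto)
  qed
  have diff: "\<phi> differentiable at x" for x
    using assms by (auto simp: C1c_def differentiable_on_def)
  then have "continuous_on UNIV \<phi>"
    by (simp add: continuous_at_imp_continuous_on differentiable_imp_continuous_within)
  then show thesis
    using K zero grad_zero GDERIV_gradient[OF diff] by (intro that[of K])
qed

lemma C1c_mult:
  fixes \<phi> \<psi> :: "'a::euclidean_space \<Rightarrow> real"
  assumes "\<phi> \<in> C1c \<Omega>" "\<psi> \<in> C1c \<Omega>"
  shows "(\<lambda>x. \<phi> x * \<psi> x) \<in> C1c \<Omega>"
proof -
  obtain K where K: "compact K" "K \<subseteq> \<Omega>" "\<And>x. x \<notin> K \<Longrightarrow> \<phi> x = 0"
    "continuous_on UNIV \<phi>" "continuous_on UNIV (gradient \<phi>)" "\<And>x. GDERIV \<phi> x :> gradient \<phi> x"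
    using C1cE[OF assms(1)] by metis
  obtain L where L: "continuous_on UNIV \<psi>" "continuous_on UNIV (gradient \<psi>)"
    "\<And>x. GDERIV \<psi> x :> gradient \<psi> x"
    using C1cE[OF assms(2)] by metis
  show ?thesis
  proof (rule C1cI)
    show "GDERIV (\<lambda>x. \<phi> x * \<psi> x) x :> \<phi> x *\<^sub>R gradient \<psi> x + \<psi> x *\<^sub>R gradient \<phi> x" for x
      by (rule GDERIV_mult[OF K(6) L(3)])
    show "continuous_on UNIV (\<lambda>x. \<phi> x *\<^sub>R gradient \<psi> x + \<psi> x *\<^sub>R gradient \<phi> x)"
      by (intro continuous_intros K L)
  qed (use K in auto)
qed

text \<open>
  For a non-negative test function \<open>\<phi>\<close> these functions increase, as \<open>m\<close> tends to infinity, to the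
  indicator of the set where \<open>\<phi>\<close> is positive. They vanish where \<open>\<phi>\<close> does and are bounded by one.
\<close>

lemma C1c_saturate:
  fixes \<phi> :: "'a::euclidean_space \<Rightarrow> real"
  assumes "\<phi> \<in> C1c \<Omega>" and nonneg: "\<And>x. 0 \<le> \<phi> x" and "0 \<le> m"
  shows "(\<lambda>x. m * \<phi> x / (1 + m * \<phi> x)) \<in> C1c \<Omega>"
proof -
  obtain K where K: "compact K" "K \<subseteq> \<Omega>" "\<And>x. x \<notin> K \<Longrightarrow> \<phi> x = 0"
    "continuous_on UNIV \<phi>" "continuous_on UNIV (gradient \<phi>)" "\<And>x. GDERIV \<phi> x :> gradient \<phi> x"
    using C1cE[OF assms(1)] by metis
  have pos: "1 + m * \<phi> x \<noteq> 0" for x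
    using mult_nonneg_nonneg[OF \<open>0 \<le> m\<close> nonneg[of x]] by (simp add: add_nonneg_eq_0_iff)
  show ?thesis
  proof (rule C1cI)
    fix x
    have "DERIV (\<lambda>t. m * t / (1 + m * t)) (\<phi> x) :>
        (m * (1 + m * \<phi> x) - m * \<phi> x * m) / ((1 + m * \<phi> x) * (1 + m * \<phi> x))"
      using pos[of x] by (auto intro!: derivative_eq_intros)
    also have "m * (1 + m * \<phi> x) - m * \<phi> x * m = m"
      by (simp add: distrib_left)
    finally have "DERIV (\<lambda>t. m * t / (1 + m * t)) (\<phi> x) :> m / (1 + m * \<phi> x)\<^sup>2"
      by (simp only: power2_eq_square)
    then show "GDERIV (\<lambda>x. m * \<phi> x / (1 + m * \<phi> x)) x :> (m / (1 + m * \<phi> x)\<^sup>2) *\<^sub>R gradient \<phi> x"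
      by (rule GDERIV_DERIV_compose[OF K(6)])
  next
    show "continuous_on UNIV (\<lambda>x. (m / (1 + m * \<phi> x)\<^sup>2) *\<^sub>R gradient \<phi> x)"
      by (intro continuous_intros K) (use pos in auto)
  qed (use K in auto)
qed

text \<open>
  Squaring smooths the corner of the positive part just enough to make it continuously differentiable.
\<close>

lemma DERIV_max_zero_power2: "DERIV (\<lambda>t::real. (max 0 t)\<^sup>2) t :> 2 * max 0 t"
proof (cases "t = 0")
  case True
  have "((\<lambda>h::real. (max 0 h)\<^sup>2 / h) \<longlongrightarrow> 0) (at 0)"
  proof (rule Lim_null_comparison)
    show "\<forall>\<^sub>F h in at 0. norm ((max 0 h)\<^sup>2 / h) \<le> \<bar>h::real\<bar>"
      by (auto simp: max_def power2_eq_square)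
    show "((\<lambda>h::real. \<bar>h\<bar>) \<longlongrightarrow> 0) (at 0)"
      by (auto intro!: tendsto_eq_intros)
  qed
  then show ?thesis
    by (simp add: DERIV_def True)
next
  case False
  show ?thesis
  proof (cases "0 < t")
    case True
    have "DERIV (\<lambda>t::real. t\<^sup>2) t :> 2 * max 0 t"
      using True by (auto intro!: derivative_eq_intros)
    then show ?thesis
      by (rule has_field_derivative_transform_within_open[where S="{0<..}"]) (use True in auto)
  next
    case False
    have "DERIV (\<lambda>t::real. 0) t :> 2 * max 0 t"
      using False by (auto intro!: derivative_eq_intros)
    then show ?thesis
      by (rule has_field_derivative_transform_within_open[where S="{..<0}"])
         (use False \<open>t \<noteq> 0\<close> in auto)
  qed
qed

lemma C1c_bump:
  fixes a :: "'a::euclidean_space"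
  assumes "cball a r \<subseteq> \<Omega>" and "0 < r"
  obtains \<phi> where "\<phi> \<in> C1c \<Omega>" "\<And>x. 0 \<le> \<phi> x" "{x. 0 < \<phi> x} = ball a r"
proof
  define p where "p x = r\<^sup>2 - (x - a) \<bullet> (x - a)" for x
  define \<phi> where "\<phi> x = (max 0 (p x))\<^sup>2" for x
  have p_pos: "0 < p x \<longleftrightarrow> x \<in> ball a r" for x
    using \<open>0 < r\<close> power_mono_iff[of r "norm (x - a)" 2]
    by (simp add: p_def dist_norm norm_minus_commute dot_square_norm not_le[symmetric])
  show "\<phi> \<in> C1c \<Omega>"
  proof (rule C1cI)
    fix x
    have p': "GDERIV p x :> - (2 *\<^sub>R (x - a))"
      unfolding gderiv_def p_def
      by (auto intro!: derivative_eq_intros simp: inner_commute algebra_simps)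
    show "GDERIV \<phi> x :> (2 * max 0 (p x)) *\<^sub>R (- (2 *\<^sub>R (x - a)))"
      unfolding \<phi>_def by (rule GDERIV_DERIV_compose[OF p' DERIV_max_zero_power2])
  next
    show "continuous_on UNIV (\<lambda>x. (2 * max 0 (p x)) *\<^sub>R (- (2 *\<^sub>R (x - a))))"
      unfolding p_def by (intro continuous_intros)
    show "\<phi> x = 0" if "x \<notin> cball a r" for x
      using that p_pos[of x] ball_subset_cball[of a r] by (auto simp: \<phi>_def max_def)
  qed (use assms in auto)
  show "0 \<le> \<phi> x" for x
    by (simp add: \<phi>_def)
  show "{x. 0 < \<phi> x} = ball a r"
  proof -
    have "0 < \<phi> x \<longleftrightarrow> 0 < p x" for x
      by (auto simp: \<phi>_def zero_less_power2 max_def)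
    then show ?thesis
      using p_pos by auto
  qed
qed

text \<open>
  These sets serve as a generator of the Borel sets of \<open>\<Omega>\<close>: they contain every open ball whose closed ball
  lies in \<open>\<Omega>\<close>, they are stable under intersection because test functions may be multiplied, and their
  indicators are monotone limits of test functions.
\<close>

definition positivity_sets :: "'a::euclidean_space set \<Rightarrow> 'a set set" where
  "positivity_sets \<Omega> = {{x. 0 < \<phi> x} |\<phi>. \<phi> \<in> C1c \<Omega> \<and> (\<forall>x. 0 \<le> \<phi> x)}"

lemma positivity_sets_open:
  assumes "U \<in> positivity_sets \<Omega>"
  shows "open U" and "\<exists>K. compact K \<and> U \<subseteq> K \<and> K \<subseteq> \<Omega>"
proof -
  obtain \<phi> where \<phi>: "\<phi> \<in> C1c \<Omega>" "U = {x. 0 < \<phi> x}"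
    using assms by (auto simp: positivity_sets_def)
  obtain K where K: "compact K" "K \<subseteq> \<Omega>" "\<And>x. x \<notin> K \<Longrightarrow> \<phi> x = 0" "continuous_on UNIV \<phi>"
    using C1cE[OF \<phi>(1)] by metis
  show "open U"
    unfolding \<phi>(2) using K(4) by (intro open_Collect_less continuous_intros) auto
  show "\<exists>K. compact K \<and> U \<subseteq> K \<and> K \<subseteq> \<Omega>"
    using K(1-3) by (force simp: \<phi>(2))
qed

lemma Int_stable_positivity_sets: "Int_stable (positivity_sets \<Omega>)"
proof (rule Int_stableI)
  fix U W :: "'a set" assume "U \<in> positivity_sets \<Omega>" "W \<in> positivity_sets \<Omega>"
  then obtain \<phi> \<psi> where *: "\<phi> \<in> C1c \<Omega>" "\<forall>x. 0 \<le> \<phi> x" "U = {x. 0 < \<phi> x}"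
    "\<psi> \<in> C1c \<Omega>" "\<forall>x. 0 \<le> \<psi> x" "W = {x. 0 < \<psi> x}"
    by (auto simp: positivity_sets_def)
  have "U \<inter> W = {x. 0 < \<phi> x * \<psi> x}"
    using *(2,5) by (auto simp: *(3,6) zero_less_mult_iff not_less[symmetric])
  then show "U \<inter> W \<in> positivity_sets \<Omega>"
    using * C1c_mult[of \<phi> \<Omega> \<psi>] by (auto simp: positivity_sets_def intro!: exI[of _ "\<lambda>x. \<phi> x * \<psi> x"])
qed

lemma open_countable_Union_positivity_sets:
  fixes U :: "'a::euclidean_space set"
  assumes "open U" "U \<subseteq> \<Omega>"
  obtains F where "countable F" "F \<subseteq> positivity_sets \<Omega>" "\<Union>F = U"
proof -
  let ?G = "{W \<in> positivity_sets \<Omega>. W \<subseteq> U}"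
  have "x \<in> \<Union>?G" if x: "x \<in> U" for x
  proof -
    obtain r where r: "0 < r" "cball x r \<subseteq> U"
      using \<open>open U\<close> x by (meson open_contains_cball)
    obtain \<phi> where "\<phi> \<in> C1c \<Omega>" "\<And>y. 0 \<le> \<phi> y" "{y. 0 < \<phi> y} = ball x r"
      using C1c_bump[of x r \<Omega>] r assms(2) by (metis subset_trans)
    then have "ball x r \<in> positivity_sets \<Omega>"
      by (force simp: positivity_sets_def)
    moreover have "ball x r \<subseteq> U" "x \<in> ball x r"
      using r ball_subset_cball by (blast, simp)
    ultimately show ?thesis by blast
  qed
  then have "\<Union>?G = U" by blast
  moreover obtain F where "F \<subseteq> ?G" "countable F" "\<Union>F = \<Union>?G"
    by (rule Lindelof[of ?G]) (use positivity_sets_open(1) in blast)+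
  ultimately show thesis
    by (intro that[of F]) blast+
qed

lemma sigma_sets_positivity_sets:
  fixes \<Omega> :: "'a::euclidean_space set"
  assumes "open \<Omega>"
  shows "sigma_sets \<Omega> (positivity_sets \<Omega>) = sets (restrict_space borel \<Omega>)"
proof -
  have sub: "positivity_sets \<Omega> \<subseteq> Pow \<Omega>"
    using positivity_sets_open(2) by blast
  have "sets (restrict_space borel \<Omega>) = (\<inter>) \<Omega> ` sigma_sets UNIV {U. open U}"
    by (simp add: sets_restrict_space borel_def)
  also have "\<dots> = sigma_sets \<Omega> ((\<inter>) \<Omega> ` {U. open U})"
    by (rule sigma_sets_Int) (use assms in auto)
  finally have restr: "sets (restrict_space borel \<Omega>) = sigma_sets \<Omega> ((\<inter>) \<Omega> ` {U. open U})" .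
  show ?thesis
    unfolding restr
  proof (intro sigma_sets_eqI)
    fix U assume "U \<in> positivity_sets \<Omega>"
    then have "U = \<Omega> \<inter> U" "open U"
      using sub positivity_sets_open(1) by auto
    then show "U \<in> sigma_sets \<Omega> ((\<inter>) \<Omega> ` {U. open U})"
      by (intro sigma_sets.Basic) blast
  next
    fix W assume "W \<in> (\<inter>) \<Omega> ` {U. open U}"
    then have "open W" "W \<subseteq> \<Omega>"
      using assms by auto
    then obtain F where F: "countable F" "F \<subseteq> positivity_sets \<Omega>" "\<Union>F = W"
      by (rule open_countable_Union_positivity_sets)
    interpret sigma_algebra \<Omega> "sigma_sets \<Omega> (positivity_sets \<Omega>)"
      by (rule sigma_algebra_sigma_sets[OF sub])
    show "W \<in> sigma_sets \<Omega> (positivity_sets \<Omega>)"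
      unfolding F(3)[symmetric] using F by (intro countable_Union) auto
  qed
qed

text \<open>
  Test functions determine a signed Radon measure. The difference of two Radon measures need not be
  a set function, so the statement is about a functional on bounded Borel functions with compact
  support that is additive on disjoint sets and continuous under dominated convergence. It vanishes
  on the indicators of positivity sets by approximation; localised to one such set \<open>W\<close>, the sets
  \<open>A\<close> for which it vanishes form a Dynkin system, and the generator is stable under intersection.
\<close>

theorem functional_vanishing_on_C1c:
  fixes \<Omega> :: "'a::euclidean_space set" and \<Lambda> :: "('a \<Rightarrow> real) \<Rightarrow> real"
  assumes "open \<Omega>"
    and add: "\<And>A B K. A \<in> sets (restrict_space borel \<Omega>) \<Longrightarrow> B \<in> sets (restrict_space borel \<Omega>) \<Longrightarrow>
      compact K \<Longrightarrow> K \<subseteq> \<Omega> \<Longrightarrow> A \<union> B \<subseteq> K \<Longrightarrow> A \<inter> B = {} \<Longrightarrow>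
      \<Lambda> (indicator (A \<union> B)) = \<Lambda> (indicator A) + \<Lambda> (indicator B)"
    and conv: "\<And>u v K. (\<And>m::nat. u m \<in> borel_measurable (restrict_space borel \<Omega>)) \<Longrightarrow>
      v \<in> borel_measurable (restrict_space borel \<Omega>) \<Longrightarrow> compact K \<Longrightarrow> K \<subseteq> \<Omega> \<Longrightarrow>
      (\<And>m x. x \<in> \<Omega> \<Longrightarrow> \<bar>u m x\<bar> \<le> indicator K x) \<Longrightarrow>
      (\<And>x. x \<in> \<Omega> \<Longrightarrow> (\<lambda>m. u m x) \<longlonglongrightarrow> v x) \<Longrightarrow> (\<lambda>m. \<Lambda> (u m)) \<longlonglongrightarrow> \<Lambda> v"
    and zero: "\<And>\<phi>. \<phi> \<in> C1c \<Omega> \<Longrightarrow> \<Lambda> \<phi> = 0"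
    and W: "W \<in> positivity_sets \<Omega>" and A: "A \<in> sets (restrict_space borel \<Omega>)"
  shows "\<Lambda> (indicator (A \<inter> W)) = 0"
proof -
  let ?B = "restrict_space borel \<Omega>"
  have space: "space ?B = \<Omega>"
    by (simp add: space_restrict_space)
  have sets_pos: "U \<in> sets ?B" if "U \<in> positivity_sets \<Omega>" for U
    using that unfolding sigma_sets_positivity_sets[OF \<open>open \<Omega>\<close>, symmetric] by (rule sigma_sets.Basic)
  have pos: "\<Lambda> (indicator U) = 0" if "U \<in> positivity_sets \<Omega>" for U
  proof -
    obtain \<phi> where \<phi>: "\<phi> \<in> C1c \<Omega>" "\<And>x. 0 \<le> \<phi> x" "U = {x. 0 < \<phi> x}"
      using \<open>U \<in> positivity_sets \<Omega>\<close> by (auto simp: positivity_sets_def)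
    obtain K where K: "compact K" "K \<subseteq> \<Omega>" "\<And>x. x \<notin> K \<Longrightarrow> \<phi> x = 0" "continuous_on UNIV \<phi>"
      using C1cE[OF \<phi>(1)] by metis
    define u where "u m x = real m * \<phi> x / (1 + real m * \<phi> x)" for m x
    have u_C1c: "u m \<in> C1c \<Omega>" for m
      using C1c_saturate[OF \<phi>(1,2), of "real m"] by (simp add: u_def[abs_def])
    have "(\<lambda>m. \<Lambda> (u m)) \<longlonglongrightarrow> \<Lambda> (indicator U)"
    proof (rule conv[where K=K])
      have "continuous_on UNIV (u m)" for m
        using C1cE[OF u_C1c[of m]] by metis
      then show "u m \<in> borel_measurable ?B" for m
        by (intro measurable_restrict_space1 borel_measurable_continuous_onI)
      show "indicator U \<in> borel_measurable ?B"
        using sets_pos[OF that] by simp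
      show "\<bar>u m x\<bar> \<le> indicator K x" for m x
      proof -
        have "0 \<le> real m * \<phi> x" by (simp add: \<phi>(2))
        then show ?thesis
          using K(3)[of x] by (cases "x \<in> K") (auto simp: u_def divide_le_eq_1)
      qed
      show "(\<lambda>m. u m x) \<longlonglongrightarrow> indicator U x" for x
      proof (cases "0 < \<phi> x")
        case True
        have "filterlim (\<lambda>m. 1 + real m * \<phi> x) at_top sequentially"
          by (rule filterlim_tendsto_add_at_top[OF tendsto_const
                filterlim_at_top_mult_tendsto_pos[OF tendsto_const True filterlim_real_sequentially]])
        then have "(\<lambda>m. 1 / (1 + real m * \<phi> x)) \<longlonglongrightarrow> 0"
          by (rule tendsto_divide_0[OF tendsto_const filterlim_at_top_imp_at_infinity])
        then have "(\<lambda>m. 1 - 1 / (1 + real m * \<phi> x)) \<longlonglongrightarrow> 1 - 0"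
          by (rule tendsto_diff[OF tendsto_const])
        moreover have "u m x = 1 - 1 / (1 + real m * \<phi> x)" for m
        proof -
          have "1 + real m * \<phi> x \<noteq> 0"
            using mult_nonneg_nonneg[of "real m" "\<phi> x"] True by linarith
          then show ?thesis by (simp add: u_def field_simps)
        qed
        ultimately show ?thesis
          using True by (simp add: \<phi>(3))
      next
        case False
        then have "\<phi> x = 0" using \<phi>(2)[of x] by simp
        then show ?thesis by (simp add: u_def \<phi>(3))
      qed
    qed (use K in auto)
    moreover have "\<Lambda> (u m) = 0" for m
      by (rule zero[OF u_C1c])
    ultimately show ?thesis
      by (simp add: LIMSEQ_const_iff)
  qed
  obtain L where L: "compact L" "W \<subseteq> L" "L \<subseteq> \<Omega>"
    using positivity_sets_open(2)[OF W] by blast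
  have W_sets: "W \<in> sets ?B"
    by (rule sets_pos[OF W])
  have add_W: "\<Lambda> (indicator (B \<union> C)) = \<Lambda> (indicator B) + \<Lambda> (indicator C)"
    if "B \<in> sets ?B" "C \<in> sets ?B" "B \<union> C \<subseteq> W" "B \<inter> C = {}" for B C
    using L by (intro add[OF that(1,2), of L]) (use that in auto)
  have \<Lambda>_empty: "\<Lambda> (indicator {}) = 0"
    using add_W[of "{}" "{}"] unfolding Un_empty_left by (metis Int_empty_left add_cancel_left_left empty_subsetI sets.empty_sets)
  have A': "A \<in> sigma_sets \<Omega> (positivity_sets \<Omega>)"
    using A sigma_sets_positivity_sets[OF \<open>open \<Omega>\<close>] by simp
  have sub: "positivity_sets \<Omega> \<subseteq> Pow \<Omega>"
    using positivity_sets_open(2) by blast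
  show ?thesis
    using Int_stable_positivity_sets sub A'
  proof (induction rule: sigma_sets_induct_disjoint)
    case (basic U)
    then show ?case
      using Int_stableD[OF Int_stable_positivity_sets _ W] by (intro pos) blast
  next
    case empty
    show ?case
      unfolding Int_empty_left by (rule \<Lambda>_empty)
  next
    case (compl B)
    then have B: "B \<in> sets ?B"
      using sigma_sets_positivity_sets[OF \<open>open \<Omega>\<close>] by simp
    have "\<Lambda> (indicator (B \<inter> W \<union> (W - B))) = \<Lambda> (indicator (B \<inter> W)) + \<Lambda> (indicator (W - B))"
    proof (rule add_W)
      show "B \<inter> W \<in> sets ?B" "W - B \<in> sets ?B"
        using B W_sets by (auto intro: sets.Int sets.Diff)
    qed auto
    moreover have "B \<inter> W \<union> (W - B) = W" "(\<Omega> - B) \<inter> W = W - B"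
      using L by auto
    ultimately show ?case
      using pos[OF W] compl.IH by (simp only: add_0)
  next
    case (union B)
    then have B: "B i \<in> sets ?B" for i
      using sigma_sets_positivity_sets[OF \<open>open \<Omega>\<close>] by auto
    let ?C = "\<lambda>m. \<Union>i<m. B i \<inter> W"
    have C: "?C m \<in> sets ?B" for m
      using B W_sets by (intro sets.finite_UN) auto
    have "\<Lambda> (indicator (?C m)) = 0" for m
    proof (induction m)
      case 0
      have "?C 0 = {}" by simp
      then show ?case by (simp only: \<Lambda>_empty)
    next
      case (Suc m)
      have "?C (Suc m) = ?C m \<union> (B m \<inter> W)"
        by (auto simp: less_Suc_eq)
      moreover have "\<Lambda> (indicator (?C m \<union> (B m \<inter> W))) = \<Lambda> (indicator (?C m)) + \<Lambda> (indicator (B m \<inter> W))"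
      proof (rule add_W[OF C])
        show "B m \<inter> W \<in> sets ?B"
          by (rule sets.Int[OF B W_sets])
        have "B i \<inter> B m = {}" if "i < m" for i
          using union.hyps(1) that by (intro disjoint_family_onD) auto
        then show "?C m \<inter> (B m \<inter> W) = {}"
          by blast
      qed blast
      ultimately show ?case
        using Suc.IH union.IH[of m] by (simp only: add_0)
    qed
    moreover have "(\<lambda>m. \<Lambda> (indicator (?C m))) \<longlonglongrightarrow> \<Lambda> (indicator ((\<Union>i. B i) \<inter> W))"
    proof (rule conv[where K=L])
      show "indicator (?C m) \<in> borel_measurable ?B" for m
        using C by simp
      show "indicator ((\<Union>i. B i) \<inter> W) \<in> borel_measurable ?B"
        using B W_sets by (intro borel_measurable_indicator) auto
      show "\<bar>indicator (?C m) x\<bar> \<le> (indicator L x :: real)" for m x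
        using L by (auto simp: indicator_def)
      have "(\<lambda>m. indicator (?C m) x :: real) \<longlonglongrightarrow> indicator (\<Union>m. ?C m) x" for x
        by (intro LIMSEQ_indicator_incseq) (auto simp: incseq_def intro: less_le_trans)
      moreover have "(\<Union>m. ?C m) = (\<Union>i. B i) \<inter> W"
        by auto
      ultimately show "(\<lambda>m. indicator (?C m) x :: real) \<longlonglongrightarrow> indicator ((\<Union>i. B i) \<inter> W) x" for x
        by simp
    qed (use L in auto)
    ultimately show ?case
      by (simp add: LIMSEQ_const_iff)
  qed
qed

section \<open>Densities of signed Radon measures\<close>

lemma C1c_bounded:
  fixes \<phi> :: "'a::euclidean_space \<Rightarrow> real"
  assumes "\<phi> \<in> C1c \<Omega>"
  obtains B K where "compact K" "K \<subseteq> \<Omega>" "\<And>x. \<bar>\<phi> x\<bar> \<le> B * indicator K x"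
proof -
  obtain K where K: "compact K" "K \<subseteq> \<Omega>" "\<And>x. x \<notin> K \<Longrightarrow> \<phi> x = 0" "continuous_on UNIV \<phi>"
    using C1cE[OF assms] by metis
  have "compact (\<phi> ` K)"
    using K(1,4) by (meson compact_continuous_image continuous_on_subset subset_UNIV)
  then obtain B where "\<forall>y\<in>\<phi> ` K. norm y \<le> B"
    using compact_imp_bounded bounded_iff by metis
  then have "\<bar>\<phi> x\<bar> \<le> B * indicator K x" for x
    using K(3) by (cases "x \<in> K") auto
  then show thesis
    using that K(1,2) by blast
qed

lemma borel_measurable_C1c: "\<phi> \<in> C1c \<Omega> \<Longrightarrow> \<phi> \<in> borel_measurable borel"
  by (metis C1cE borel_measurable_continuous_onI)

lemma integrable_L1_loc_C1c:
  assumes M: "radon_measure_on \<Omega> M" and f: "f \<in> L1_loc \<Omega> M" and \<phi>: "\<phi> \<in> C1c \<Omega>"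
  shows "integrable M (\<lambda>x. f x * \<phi> x)"
proof -
  obtain B K where "compact K" "K \<subseteq> \<Omega>" "\<And>x. \<bar>\<phi> x\<bar> \<le> B * indicator K x"
    using C1c_bounded[OF \<phi>] by metis
  then show ?thesis
    using borel_measurable_radonI[OF M borel_measurable_C1c[OF \<phi>]]
    by (intro integrable_L1_loc_mult[OF M f])
qed

lemma integrable_C1c:
  assumes "radon_measure_on \<Omega> M" and "\<phi> \<in> C1c \<Omega>"
  shows "integrable M \<phi>"
  using integrable_L1_loc_C1c[OF assms(1) one_L1_loc[OF assms(1)] assms(2)] by simp

lemma integrable_L1_loc_indicator:
  assumes M: "radon_measure_on \<Omega> M" and f: "f \<in> L1_loc \<Omega> M"
    and A: "A \<in> sets M" and K: "compact K" "K \<subseteq> \<Omega>" "A \<subseteq> K"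
  shows "integrable M (\<lambda>x. f x * indicator A x)"
  by (rule integrable_L1_loc_mult[OF M f K(1,2), where B=1]) (use A K(3) in \<open>auto simp: indicator_def\<close>)

lemma integral_L1_loc_disjoint_Un:
  assumes M: "radon_measure_on \<Omega> M" and f: "f \<in> L1_loc \<Omega> M"
    and A: "A \<in> sets M" and B: "B \<in> sets M" and K: "compact K" "K \<subseteq> \<Omega>" "A \<union> B \<subseteq> K" and "A \<inter> B = {}"
  shows "(\<integral>x. f x * indicator (A \<union> B) x \<partial>M) =
    (\<integral>x. f x * indicator A x \<partial>M) + (\<integral>x. f x * indicator B x \<partial>M)"
proof -
  have "(\<integral>x. f x * indicator (A \<union> B) x \<partial>M) = (\<integral>x. f x * indicator A x + f x * indicator B x \<partial>M)"
    using \<open>A \<inter> B = {}\<close> by (intro Bochner_Integration.integral_cong) (auto simp: indicator_def)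
  also have "\<dots> = (\<integral>x. f x * indicator A x \<partial>M) + (\<integral>x. f x * indicator B x \<partial>M)"
    using A B K by (intro Bochner_Integration.integral_add integrable_L1_loc_indicator[OF M f]) auto
  finally show ?thesis .
qed

lemma integral_L1_loc_tendsto:
  assumes M: "radon_measure_on \<Omega> M" and f: "f \<in> L1_loc \<Omega> M"
    and meas: "\<And>m::nat. u m \<in> borel_measurable M" "v \<in> borel_measurable M"
    and K: "compact K" "K \<subseteq> \<Omega>"
    and bound: "\<And>m x. x \<in> \<Omega> \<Longrightarrow> \<bar>u m x\<bar> \<le> indicator K x"
    and lim: "\<And>x. x \<in> \<Omega> \<Longrightarrow> (\<lambda>m. u m x) \<longlonglongrightarrow> v x"
  shows "(\<lambda>m. \<integral>x. f x * u m x \<partial>M) \<longlonglongrightarrow> (\<integral>x. f x * v x \<partial>M)"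
proof (rule integral_dominated_convergence)
  have f_meas: "f \<in> borel_measurable M"
    using f by (simp add: L1_loc_def)
  show "integrable M (\<lambda>x. \<bar>indicator K x * f x\<bar>)"
    using f K by (auto simp: L1_loc_def set_integrable_def)
  show "(\<lambda>x. f x * v x) \<in> borel_measurable M" "\<And>m. (\<lambda>x. f x * u m x) \<in> borel_measurable M"
    using f_meas meas by auto
  show "AE x in M. (\<lambda>m. f x * u m x) \<longlonglongrightarrow> f x * v x"
    using lim radon_measure_onD(2)[OF M] by (auto intro!: AE_I2 tendsto_intros)
  have "\<bar>f x * u m x\<bar> \<le> \<bar>indicator K x * f x\<bar>" if "x \<in> \<Omega>" for x m
    using mult_left_mono[OF bound[OF that, of m], of "\<bar>f x\<bar>"] by (simp add: abs_mult mult.commute)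
  then show "AE x in M. norm (f x * u m x) \<le> \<bar>indicator K x * f x\<bar>" for m
    using radon_measure_onD(2)[OF M] by (auto intro!: AE_I2)
qed

text \<open>
  The linear relation extends from test functions to indicators of Borel subsets of a positivity set,
  by \<open>functional_vanishing_on_C1c\<close>. On the part of \<open>{h > 0}\<close> outside a null set carrying all
  singular parts, where \<open>h\<close> is the combination of the densities, only the integral of \<open>h\<close> remains;
  it is zero although \<open>h\<close> is positive there, so this part is null.
\<close>

lemma ac_density_relation_nonpos:
  fixes \<Omega> :: "'a::euclidean_space set"
  assumes \<Omega>: "open \<Omega>" and M: "radon_measure_on \<Omega> M" and I: "finite I"
    and dens: "\<And>i. i \<in> I \<Longrightarrow> is_ac_density \<Omega> M (L i) (f i)"
    and rel: "\<And>\<phi>. \<phi> \<in> C1c \<Omega> \<Longrightarrow> (\<Sum>i\<in>I. c i * L i \<phi>) = 0"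
  shows "AE x in M. (\<Sum>i\<in>I. c i * f i x) \<le> 0"
proof -
  have f: "f i \<in> L1_loc \<Omega> M" if "i \<in> I" for i
    using dens[OF that] by (simp add: is_ac_density_def)
  \<comment> \<open>\<open>Q i (\<sigma>, \<tau>, N)\<close>: a decomposition of \<open>L i\<close> whose singular parts both live on the null set \<open>N\<close>\<close>
  define Q where "Q i t \<longleftrightarrow> (case t of (\<sigma>, \<tau>, N) \<Rightarrow>
      radon_measure_on \<Omega> \<sigma> \<and> radon_measure_on \<Omega> \<tau> \<and> N \<in> null_sets M \<and>
      emeasure \<sigma> (space M - N) = 0 \<and> emeasure \<tau> (space M - N) = 0 \<and>
      (\<forall>\<phi>\<in>C1c \<Omega>. L i \<phi> = (\<integral>x. f i x * \<phi> x \<partial>M) + ((\<integral>x. \<phi> x \<partial>\<sigma>) - (\<integral>x. \<phi> x \<partial>\<tau>))))" for i t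
  have "\<exists>t. Q i t"
    if i: "i \<in> I" for i
  proof -
    obtain \<sigma> \<tau> where *: "radon_measure_on \<Omega> \<sigma>" "radon_measure_on \<Omega> \<tau>" "singular_wrt \<sigma> M" "singular_wrt \<tau> M"
      "\<forall>\<phi>\<in>C1c \<Omega>. L i \<phi> = (\<integral>x. f i x * \<phi> x \<partial>M) + ((\<integral>x. \<phi> x \<partial>\<sigma>) - (\<integral>x. \<phi> x \<partial>\<tau>))"
      using dens[OF i] unfolding is_ac_density_def by blast
    obtain N N' where N: "N \<in> null_sets M" "emeasure \<sigma> (space M - N) = 0"
      and N': "N' \<in> null_sets M" "emeasure \<tau> (space M - N') = 0"
      using *(3,4) unfolding singular_wrt_def by (metis null_setsI)
    have sets: "space M - N \<in> sets \<sigma>" "space M - N' \<in> sets \<tau>"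
      using N N' M *(1,2) by (auto simp: radon_measure_on_def)
    have "emeasure \<sigma> (space M - (N \<union> N')) = 0" "emeasure \<tau> (space M - (N \<union> N')) = 0"
      using emeasure_mono[OF _ sets(1), of "space M - (N \<union> N')"]
        emeasure_mono[OF _ sets(2), of "space M - (N \<union> N')"] N N' by auto
    then have "Q i (\<sigma>, \<tau>, N \<union> N')"
      using * N(1) N'(1) by (simp add: Q_def null_sets.Un)
    then show ?thesis ..
  qed
  then obtain t where t: "\<And>i. i \<in> I \<Longrightarrow> Q i (t i)"
    by metis
  define \<sigma> \<tau> N where "\<sigma> i = fst (t i)" and "\<tau> i = fst (snd (t i))" and "N i = snd (snd (t i))" for i
  note Q_t = t[unfolded Q_def case_prod_beta, folded \<sigma>_def \<tau>_def N_def]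
  have \<sigma>: "radon_measure_on \<Omega> (\<sigma> i)" and \<tau>: "radon_measure_on \<Omega> (\<tau> i)"
    and N: "N i \<in> null_sets M"
    and \<sigma>N: "emeasure (\<sigma> i) (space M - N i) = 0" and \<tau>N: "emeasure (\<tau> i) (space M - N i) = 0"
    if "i \<in> I" for i
    using Q_t[OF that] by blast+
  have L: "L i \<phi> = (\<integral>x. f i x * \<phi> x \<partial>M) + ((\<integral>x. \<phi> x \<partial>\<sigma> i) - (\<integral>x. \<phi> x \<partial>\<tau> i))"
    if "i \<in> I" "\<phi> \<in> C1c \<Omega>" for i \<phi>
    using Q_t[OF that(1)] that(2) by blast
  \<comment> \<open>the factors 1 are densities, so that the lemmas on locally integrable densities cover all terms\<close>
  define \<Lambda> where "\<Lambda> u = (\<Sum>i\<in>I. c i *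
    ((\<integral>x. f i x * u x \<partial>M) + ((\<integral>x. 1 * u x \<partial>\<sigma> i) - (\<integral>x. 1 * u x \<partial>\<tau> i))))" for u :: "'a \<Rightarrow> real"
  have sets: "sets M = sets (restrict_space borel \<Omega>)"
    "\<And>i. i \<in> I \<Longrightarrow> sets (\<sigma> i) = sets (restrict_space borel \<Omega>)"
    "\<And>i. i \<in> I \<Longrightarrow> sets (\<tau> i) = sets (restrict_space borel \<Omega>)"
    using M \<sigma> \<tau> by (auto simp: radon_measure_on_def)
  have meas: "u \<in> borel_measurable M" "\<And>i. i \<in> I \<Longrightarrow> u \<in> borel_measurable (\<sigma> i)"
    "\<And>i. i \<in> I \<Longrightarrow> u \<in> borel_measurable (\<tau> i)"
    if "u \<in> borel_measurable (restrict_space borel \<Omega>)" for u :: "'a \<Rightarrow> real"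
    using that sets by (simp_all cong: measurable_cong_sets)
  have \<Lambda>: "\<Lambda> (indicator (A \<inter> W)) = 0"
    if "W \<in> positivity_sets \<Omega>" "A \<in> sets (restrict_space borel \<Omega>)" for A W
  proof (rule functional_vanishing_on_C1c[OF \<Omega> _ _ _ that])
    fix A B K assume *: "A \<in> sets (restrict_space borel \<Omega>)" "B \<in> sets (restrict_space borel \<Omega>)"
      "compact K" "K \<subseteq> \<Omega>" "A \<union> B \<subseteq> K" "A \<inter> B = {}"
    have "c i * ((\<integral>x. f i x * indicator (A \<union> B) x \<partial>M) +
          ((\<integral>x. 1 * indicator (A \<union> B) x \<partial>\<sigma> i) - (\<integral>x. 1 * indicator (A \<union> B) x \<partial>\<tau> i))) =
        c i * ((\<integral>x. f i x * indicator A x \<partial>M) +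
          ((\<integral>x. 1 * indicator A x \<partial>\<sigma> i) - (\<integral>x. 1 * indicator A x \<partial>\<tau> i))) +
        c i * ((\<integral>x. f i x * indicator B x \<partial>M) +
          ((\<integral>x. 1 * indicator B x \<partial>\<sigma> i) - (\<integral>x. 1 * indicator B x \<partial>\<tau> i)))" if "i \<in> I" for i
      using integral_L1_loc_disjoint_Un[OF M f[OF that] _ _ *(3-6)]
        integral_L1_loc_disjoint_Un[OF \<sigma>[OF that] one_L1_loc[OF \<sigma>[OF that]] _ _ *(3-6)]
        integral_L1_loc_disjoint_Un[OF \<tau>[OF that] one_L1_loc[OF \<tau>[OF that]] _ _ *(3-6)]
        sets(1) sets(2,3)[OF that] *(1,2)
      by (simp only: distrib_left right_diff_distrib)
    then show "\<Lambda> (indicator (A \<union> B)) = \<Lambda> (indicator A) + \<Lambda> (indicator B)"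
      unfolding \<Lambda>_def sum.distrib[symmetric] by (rule sum.cong[OF refl])
  next
    fix u :: "nat \<Rightarrow> 'a \<Rightarrow> real" and v K
    assume *: "\<And>m. u m \<in> borel_measurable (restrict_space borel \<Omega>)"
      "v \<in> borel_measurable (restrict_space borel \<Omega>)" "compact K" "K \<subseteq> \<Omega>"
      "\<And>m x. x \<in> \<Omega> \<Longrightarrow> \<bar>u m x\<bar> \<le> indicator K x"
      "\<And>x. x \<in> \<Omega> \<Longrightarrow> (\<lambda>m. u m x) \<longlonglongrightarrow> v x"
    show "(\<lambda>m. \<Lambda> (u m)) \<longlonglongrightarrow> \<Lambda> v"
      unfolding \<Lambda>_def
    proof (intro tendsto_sum tendsto_mult tendsto_add tendsto_diff tendsto_const)
      fix i assume i: "i \<in> I"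
      show "(\<lambda>m. \<integral>x. f i x * u m x \<partial>M) \<longlonglongrightarrow> (\<integral>x. f i x * v x \<partial>M)"
        by (rule integral_L1_loc_tendsto[OF M f[OF i] meas(1)[OF *(1)] meas(1)[OF *(2)] *(3-6)])
      show "(\<lambda>m. \<integral>x. 1 * u m x \<partial>\<sigma> i) \<longlonglongrightarrow> (\<integral>x. 1 * v x \<partial>\<sigma> i)"
        by (rule integral_L1_loc_tendsto[OF \<sigma>[OF i] one_L1_loc[OF \<sigma>[OF i]]
              meas(2)[OF *(1) i] meas(2)[OF *(2) i] *(3-6)])
      show "(\<lambda>m. \<integral>x. 1 * u m x \<partial>\<tau> i) \<longlonglongrightarrow> (\<integral>x. 1 * v x \<partial>\<tau> i)"
        by (rule integral_L1_loc_tendsto[OF \<tau>[OF i] one_L1_loc[OF \<tau>[OF i]]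
              meas(3)[OF *(1) i] meas(3)[OF *(2) i] *(3-6)])
    qed
  next
    fix \<phi> assume "\<phi> \<in> C1c \<Omega>"
    then have "\<Lambda> \<phi> = (\<Sum>i\<in>I. c i * L i \<phi>)"
      unfolding \<Lambda>_def by (intro sum.cong refl) (simp add: L)
    then show "\<Lambda> \<phi> = 0"
      using rel[OF \<open>\<phi> \<in> C1c \<Omega>\<close>] by simp
  qed
  define h where "h x = (\<Sum>i\<in>I. c i * f i x)" for x
  have h: "h \<in> L1_loc \<Omega> M"
    unfolding h_def by (intro L1_loc_sum L1_loc_cmult f)
  have h_meas [measurable]: "h \<in> borel_measurable M"
    using h by (simp add: L1_loc_def)
  define Z where "Z = (\<Union>i\<in>I. N i)"
  have Z: "Z \<in> null_sets M"
    unfolding Z_def using I N by (intro null_sets_UN') (auto intro: countable_finite)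
  have [measurable]: "Z \<in> sets M" using Z by auto
  define A where "A = {x\<in>space M. 0 < h x} - Z"
  have A [measurable]: "A \<in> sets M"
    unfolding A_def by measurable
  have loc: "AE x in M. x \<in> W \<longrightarrow> h x \<le> 0" if W: "W \<in> positivity_sets \<Omega>" for W
  proof -
    obtain K where K: "compact K" "W \<subseteq> K" "K \<subseteq> \<Omega>"
      using positivity_sets_open(2)[OF W] by blast
    have AW: "A \<inter> W \<in> sets M"
      using sets_radonI[OF M, of W] positivity_sets_open(1)[OF W] K by (intro sets.Int A) auto
    have null: "(\<integral>x. 1 * indicator (A \<inter> W) x \<partial>\<rho>) = (0::real)"
      if "radon_measure_on \<Omega> \<rho>" "emeasure \<rho> (space M - N i) = 0" "i \<in> I" for \<rho> i
    proof -
      have "space M - N i \<in> sets \<rho>"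
        using N[OF that(3)] M that(1) by (auto simp: radon_measure_on_def)
      then have "emeasure \<rho> (A \<inter> W) \<le> emeasure \<rho> (space M - N i)"
        using that(3) by (intro emeasure_mono) (auto simp: A_def Z_def)
      moreover have "A \<inter> W \<in> sets \<rho>"
        using AW M that(1) by (simp add: radon_measure_on_def)
      ultimately have "A \<inter> W \<in> null_sets \<rho>"
        using that(2) by auto
      then have "AE x in \<rho>. x \<notin> A \<inter> W"
        by (rule AE_not_in)
      then show ?thesis
        by (intro integral_eq_zero_AE) (auto elim!: eventually_mono simp: indicator_def)
    qed
    have "0 = \<Lambda> (indicator (A \<inter> W))"
      using \<Lambda>[OF W] A sets(1) by simp
    also have "\<dots> = (\<Sum>i\<in>I. c i * (\<integral>x. f i x * indicator (A \<inter> W) x \<partial>M))"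
      unfolding \<Lambda>_def using null[OF \<sigma> \<sigma>N] null[OF \<tau> \<tau>N] by (intro sum.cong refl) simp
    also have "\<dots> = (\<integral>x. (\<Sum>i\<in>I. c i * (f i x * indicator (A \<inter> W) x)) \<partial>M)"
      using integrable_L1_loc_indicator[OF M f AW K(1) K(3)] K(2) by (subst Bochner_Integration.integral_sum) auto
    also have "\<dots> = (\<integral>x. h x * indicator (A \<inter> W) x \<partial>M)"
      by (simp add: h_def sum_distrib_right mult.assoc)
    finally have "(\<integral>x. h x * indicator (A \<inter> W) x \<partial>M) = 0" by simp
    moreover have "integrable M (\<lambda>x. h x * indicator (A \<inter> W) x)"
      using integrable_L1_loc_indicator[OF M h AW K(1) K(3)] K(2) by auto
    ultimately have "AE x in M. h x * indicator (A \<inter> W) x = 0"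
      by (subst (asm) integral_nonneg_eq_0_iff_AE) (auto simp: A_def indicator_def)
    moreover have "AE x in M. x \<notin> Z"
      by (rule AE_not_in[OF Z])
    ultimately show ?thesis
      by (rule AE_mp[OF _ AE_mp]) (auto intro!: AE_I2 simp: A_def indicator_def split: if_splits)
  qed
  obtain F where F: "countable F" "F \<subseteq> positivity_sets \<Omega>" "\<Union>F = \<Omega>"
    using open_countable_Union_positivity_sets[OF \<Omega> subset_refl] by metis
  have "AE x in M. \<forall>W\<in>F. x \<in> W \<longrightarrow> h x \<le> 0"
    using F loc by (subst AE_ball_countable) auto
  then have "AE x in M. h x \<le> 0"
    by (rule AE_mp) (use F(3) radon_measure_onD(2)[OF M] in \<open>auto intro!: AE_I2\<close>)
  then show ?thesis
    by (simp add: h_def)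
qed

text \<open>
  Densities depend linearly on the functional, whichever Lebesgue decompositions are chosen. In
  particular a density is unique up to a null set.
\<close>

theorem ac_density_relation:
  fixes \<Omega> :: "'a::euclidean_space set"
  assumes \<Omega>: "open \<Omega>" and M: "radon_measure_on \<Omega> M" and I: "finite I"
    and dens: "\<And>i. i \<in> I \<Longrightarrow> is_ac_density \<Omega> M (L i) (f i)"
    and rel: "\<And>\<phi>. \<phi> \<in> C1c \<Omega> \<Longrightarrow> (\<Sum>i\<in>I. c i * L i \<phi>) = 0"
  shows "AE x in M. (\<Sum>i\<in>I. c i * f i x) = 0"
proof -
  have "AE x in M. (\<Sum>i\<in>I. c i * f i x) \<le> 0"
    by (rule ac_density_relation_nonpos[OF \<Omega> M I dens rel])
  moreover have "AE x in M. (\<Sum>i\<in>I. - c i * f i x) \<le> 0"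
    by (rule ac_density_relation_nonpos[OF \<Omega> M I dens]) (simp_all add: rel sum_negf)
  ultimately show ?thesis
    by (rule AE_mp[OF _ AE_mp]) (auto intro!: AE_I2 simp: sum_negf)
qed

text \<open>
  The form used below; the single functional on the right is adjoined to the index set as \<open>None\<close>.
\<close>

corollary ac_density_sum:
  fixes \<Omega> :: "'a::euclidean_space set"
  assumes "open \<Omega>" "radon_measure_on \<Omega> M" "finite I"
    and dens: "\<And>i. i \<in> I \<Longrightarrow> is_ac_density \<Omega> M (L i) (f i)"
    and dens': "is_ac_density \<Omega> M L' g"
    and rel: "\<And>\<phi>. \<phi> \<in> C1c \<Omega> \<Longrightarrow> (\<Sum>i\<in>I. L i \<phi>) = c * L' \<phi>"
  shows "AE x in M. (\<Sum>i\<in>I. f i x) = c * g x"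
proof -
  let ?J = "insert None (Some ` I)"
  have sum_J: "sum F ?J = F None + (\<Sum>i\<in>I. F (Some i))" for F :: "'b option \<Rightarrow> real"
    using \<open>finite I\<close> by (subst sum.insert) (auto simp: sum.reindex)
  have "AE x in M. (\<Sum>j\<in>?J. (case j of None \<Rightarrow> - c | Some i \<Rightarrow> 1) * (case j of None \<Rightarrow> g | Some i \<Rightarrow> f i) x) = 0"
    by (rule ac_density_relation[where L="\<lambda>j. case j of None \<Rightarrow> L' | Some i \<Rightarrow> L i"])
       (use assms(1-3) in \<open>auto simp: sum_J rel dens dens'\<close>)
  then show ?thesis
    by (simp add: sum_J)
qed

lemma is_signed_radon_sum:
  fixes \<Omega> :: "'a::euclidean_space set"
  assumes "\<And>i. i \<in> I \<Longrightarrow> is_signed_radon \<Omega> (L i)"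
  shows "is_signed_radon \<Omega> (\<lambda>\<phi>. \<Sum>i\<in>I. L i \<phi>)"
  using assms
proof (induction I rule: infinite_finite_induct)
  case (insert i I)
  obtain \<sigma> \<tau> where 1: "radon_measure_on \<Omega> \<sigma>" "radon_measure_on \<Omega> \<tau>"
    "\<And>\<phi>. \<phi> \<in> C1c \<Omega> \<Longrightarrow> L i \<phi> = (\<integral>x. \<phi> x \<partial>\<sigma>) - (\<integral>x. \<phi> x \<partial>\<tau>)"
    using insert.prems[of i] unfolding is_signed_radon_def by blast
  obtain \<sigma>' \<tau>' where 2: "radon_measure_on \<Omega> \<sigma>'" "radon_measure_on \<Omega> \<tau>'"
    "\<And>\<phi>. \<phi> \<in> C1c \<Omega> \<Longrightarrow> (\<Sum>i\<in>I. L i \<phi>) = (\<integral>x. \<phi> x \<partial>\<sigma>') - (\<integral>x. \<phi> x \<partial>\<tau>')"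
    using insert.IH insert.prems unfolding is_signed_radon_def by blast
  have sets: "sets \<sigma>' = sets \<sigma>" "sets \<tau>' = sets \<tau>"
    using 1 2 by (auto simp: radon_measure_on_def)
  show ?case
    unfolding is_signed_radon_def
  proof (intro exI conjI ballI)
    show "radon_measure_on \<Omega> (measure_plus \<sigma> \<sigma>')" "radon_measure_on \<Omega> (measure_plus \<tau> \<tau>')"
      using 1 2 by (auto intro: radon_measure_plus)
    fix \<phi> assume \<phi>: "\<phi> \<in> C1c \<Omega>"
    show "(\<Sum>i\<in>insert i I. L i \<phi>) =
        (\<integral>x. \<phi> x \<partial>measure_plus \<sigma> \<sigma>') - (\<integral>x. \<phi> x \<partial>measure_plus \<tau> \<tau>')"
      using insert.hyps 1(3)[OF \<phi>] 2(3)[OF \<phi>] integrable_C1c[OF 1(1) \<phi>] integrable_C1c[OF 1(2) \<phi>]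
        integrable_C1c[OF 2(1) \<phi>] integrable_C1c[OF 2(2) \<phi>]
      by (simp add: integral_measure_plus sets)
  qed
qed (force simp: is_signed_radon_def radon_measure_on_def
       intro: exI[of _ "null_measure (restrict_space borel \<Omega>)"])+

text \<open>
  The choice in the definition of the density is from a non-empty set: decompose both measures whose
  difference represents \<open>L\<close>.
\<close>

lemma is_ac_density_ac_density:
  fixes \<Omega> :: "'a::euclidean_space set"
  assumes \<Omega>: "open \<Omega>" and M: "radon_measure_on \<Omega> M" and L: "is_signed_radon \<Omega> L"
  shows "is_ac_density \<Omega> M L (ac_density \<Omega> M L)"
proof -
  obtain \<sigma> \<tau> where *: "radon_measure_on \<Omega> \<sigma>" "radon_measure_on \<Omega> \<tau>"
    "\<And>\<phi>. \<phi> \<in> C1c \<Omega> \<Longrightarrow> L \<phi> = (\<integral>x. \<phi> x \<partial>\<sigma>) - (\<integral>x. \<phi> x \<partial>\<tau>)"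
    using L unfolding is_signed_radon_def by blast
  obtain h \<sigma>s where h: "h \<in> L1_loc \<Omega> M" "radon_measure_on \<Omega> \<sigma>s" "singular_wrt \<sigma>s M"
    "\<And>u :: 'a \<Rightarrow> real. integrable \<sigma> u \<Longrightarrow> (\<integral>x. u x \<partial>\<sigma>) = (\<integral>x. h x * u x \<partial>M) + (\<integral>x. u x \<partial>\<sigma>s)"
    using Lebesgue_decomposition_radon[OF \<Omega> M *(1)] by metis
  obtain k \<tau>s where k: "k \<in> L1_loc \<Omega> M" "radon_measure_on \<Omega> \<tau>s" "singular_wrt \<tau>s M"
    "\<And>u :: 'a \<Rightarrow> real. integrable \<tau> u \<Longrightarrow> (\<integral>x. u x \<partial>\<tau>) = (\<integral>x. k x * u x \<partial>M) + (\<integral>x. u x \<partial>\<tau>s)"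
    using Lebesgue_decomposition_radon[OF \<Omega> M *(2)] by metis
  have "is_ac_density \<Omega> M L (\<lambda>x. h x + (- 1) * k x)"
    unfolding is_ac_density_def
  proof (intro conjI exI ballI)
    show "(\<lambda>x. h x + (- 1) * k x) \<in> L1_loc \<Omega> M"
      by (intro L1_loc_add L1_loc_cmult h k)
    fix \<phi> assume \<phi>: "\<phi> \<in> C1c \<Omega>"
    have "(\<integral>x. (h x + (- 1) * k x) * \<phi> x \<partial>M) = (\<integral>x. h x * \<phi> x \<partial>M) - (\<integral>x. k x * \<phi> x \<partial>M)"
      using integrable_L1_loc_C1c[OF M h(1) \<phi>] integrable_L1_loc_C1c[OF M k(1) \<phi>]
      by (simp add: left_diff_distrib)
    then show "L \<phi> = (\<integral>x. (h x + (- 1) * k x) * \<phi> x \<partial>M) + ((\<integral>x. \<phi> x \<partial>\<sigma>s) - (\<integral>x. \<phi> x \<partial>\<tau>s))"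
      using *(3)[OF \<phi>] h(4)[OF integrable_C1c[OF *(1) \<phi>]] k(4)[OF integrable_C1c[OF *(2) \<phi>]] by simp
  qed (use h k in auto)
  then show ?thesis
    unfolding ac_density_def by (rule someI[of "is_ac_density \<Omega> M L"])
qed

lemma ac_density_cong:
  assumes "\<And>\<phi>. \<phi> \<in> C1c \<Omega> \<Longrightarrow> L \<phi> = L' \<phi>"
  shows "ac_density \<Omega> M L = ac_density \<Omega> M L'"
  using assms by (simp add: ac_density_def is_ac_density_def cong: conj_cong)

section \<open>Varifolds\<close>

text \<open>
  Compactness of the Grassmannian enters here: the preimage of a compact set is compact.
\<close>

lemma mass_radon:
  fixes V :: "((real^'n) \<times> (real^'n^'n)) measure"
  assumes V: "varifold d \<Omega> V"
  shows "radon_measure_on \<Omega> (mass \<Omega> V)"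
proof -
  have V': "radon_measure_on (\<Omega> \<times> grassmannian d) V"
    using V by (simp add: varifold_def)
  note space = radon_measure_onD(2)[OF V']
  have "fst \<in> measurable V borel"
    by (rule borel_measurable_radonI[OF V']) (simp add: borel_measurable_continuous_onI continuous_on_fst)
  then have meas: "fst \<in> measurable V (restrict_space borel \<Omega>)"
    by (intro measurable_restrict_space2) (auto simp: space)
  have "emeasure (mass \<Omega> V) K < \<infinity>" if K: "compact K" "K \<subseteq> \<Omega>" for K
  proof -
    have "K \<in> sets (restrict_space borel \<Omega>)"
      using K borel_compact[OF K(1)] by (auto simp: sets_restrict_space)
    then have "emeasure (mass \<Omega> V) K = emeasure V (fst -` K \<inter> space V)"
      by (simp add: mass_def emeasure_distr[OF meas])
    also have "fst -` K \<inter> space V = K \<times> grassmannian d"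
      using K(2) by (auto simp: space)
    also have "emeasure V \<dots> < \<infinity>"
      using K by (intro radon_measure_onD(3)[OF V'] compact_Times compact_grassmannian) auto
    finally show ?thesis .
  qed
  then show ?thesis
    by (simp add: radon_measure_on_def mass_def)
qed

lemma integrable_varifold:
  fixes V :: "((real^'n) \<times> (real^'n^'n)) measure" and F :: "_ \<Rightarrow> 'b::{banach, second_countable_topology}"
  assumes V: "varifold d \<Omega> V" and cont: "continuous_on UNIV F"
    and K: "compact K" "K \<subseteq> \<Omega>" and supp: "\<And>y S. y \<notin> K \<Longrightarrow> F (y, S) = 0"
  shows "integrable V F"
proof -
  have V': "radon_measure_on (\<Omega> \<times> grassmannian d) V"
    using V by (simp add: varifold_def)
  let ?K = "K \<times> grassmannian d"
  have cpt: "compact ?K"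
    using K(1) by (intro compact_Times compact_grassmannian)
  have sub: "?K \<subseteq> \<Omega> \<times> grassmannian d"
    using K(2) by auto
  have "compact (F ` ?K)"
    by (rule compact_continuous_image[OF continuous_on_subset[OF cont subset_UNIV] cpt])
  then obtain B where B: "\<And>p. p \<in> ?K \<Longrightarrow> norm (F p) \<le> B"
    using compact_imp_bounded bounded_iff by (metis imageI)
  show ?thesis
  proof (rule integrableI_bounded_set)
    show "?K \<in> sets V"
      using cpt sub by (intro sets_radonI[OF V'] borel_compact)
    show "F \<in> borel_measurable V"
      by (intro borel_measurable_radonI[OF V'] borel_measurable_continuous_onI cont)
    show "emeasure V ?K < \<infinity>"
      by (rule radon_measure_onD(3)[OF V' cpt sub])
    show "AE p in V. p \<in> ?K \<longrightarrow> norm (F p) \<le> B"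
      using B by (intro AE_I2) blast
    show "AE p in V. p \<notin> ?K \<longrightarrow> F p = 0"
      using supp radon_measure_onD(2)[OF V'] by (intro AE_I2) auto
  qed
qed

lemma continuous_on_matrix_vector_mult [continuous_intros]:
  fixes A :: "'a::topological_space \<Rightarrow> real^'n^'m" and x :: "'a \<Rightarrow> real^'n"
  assumes "continuous_on T A" "continuous_on T x"
  shows "continuous_on T (\<lambda>t. A t *v x t)"
  unfolding matrix_vector_mult_def by (intro continuous_intros assms)

lemma
  fixes V :: "((real^'n) \<times> (real^'n^'n)) measure"
  assumes V: "varifold d \<Omega> V" and \<phi>: "\<phi> \<in> C1c \<Omega>"
  shows integrable_G_variation:
      "integrable V (\<lambda>(y, S). S $ j $ k * ((S *v gradient \<phi> y) \<bullet> axis i 1))"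
    and integrable_first_variation: "integrable V (\<lambda>(y, S). S *v gradient \<phi> y)"
proof -
  obtain K where K: "compact K" "K \<subseteq> \<Omega>" "\<And>x. x \<notin> K \<Longrightarrow> gradient \<phi> x = 0"
    "continuous_on UNIV (gradient \<phi>)"
    using C1cE[OF \<phi>] by metis
  have grad: "continuous_on UNIV (\<lambda>p. gradient \<phi> (fst p))"
    by (rule continuous_on_compose2[OF K(4)]) (auto intro: continuous_intros)
  show "integrable V (\<lambda>(y, S). S $ j $ k * ((S *v gradient \<phi> y) \<bullet> axis i 1))"
    by (rule integrable_varifold[OF V _ K(1,2)])
       (auto simp: case_prod_beta K(3) intro!: continuous_intros grad)
  show "integrable V (\<lambda>(y, S). S *v gradient \<phi> y)"
    by (rule integrable_varifold[OF V _ K(1,2)])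
       (auto simp: case_prod_beta K(3) intro!: continuous_intros grad)
qed

lemma space_varifold:
  assumes "varifold d \<Omega> V"
  shows "space V = \<Omega> \<times> grassmannian d"
  using assms radon_measure_onD(2) unfolding varifold_def by blast

text \<open>
  Projection matrices are symmetric.
\<close>

lemma G_variation_sym:
  fixes V :: "((real^'n) \<times> (real^'n^'n)) measure"
  assumes V: "varifold d \<Omega> V"
  shows "G_variation V i j k \<phi> = G_variation V i k j \<phi>"
  unfolding G_variation_def
proof (rule Bochner_Integration.integral_cong[OF refl], clarify)
  fix y and S :: "real^'n^'n"
  assume "(y, S) \<in> space V"
  then have "transpose S = S"
    by (auto simp: space_varifold[OF V] grassmannian_iff)
  then have "S $ j $ k = S $ k $ j"
    by (simp add: transpose_def vec_eq_iff)
  then show "S $ j $ k * ((S *v gradient \<phi> y) \<bullet> axis i 1) = S $ k $ j * ((S *v gradient \<phi> y) \<bullet> axis i 1)"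
    by simp
qed

text \<open>
  The first identity is \<open>tr S = d\<close>; the second is \<open>S S = S\<close>, as contracting \<open>S\<^sub>i\<^sub>q\<close> with the components of
  \<open>S \<nabla>\<phi>\<close> applies \<open>S\<close> once more.
\<close>

lemma
  fixes V :: "((real^'n) \<times> (real^'n^'n)) measure"
  assumes V: "varifold d \<Omega> V" and \<phi>: "\<phi> \<in> C1c \<Omega>"
  shows G_variation_trace_last: "(\<Sum>q\<in>UNIV. G_variation V i q q \<phi>) = real d * first_variation V \<phi> $ i"
    and G_variation_trace_outer: "(\<Sum>q\<in>UNIV. G_variation V q i q \<phi>) = first_variation V \<phi> $ i"
proof -
  let ?g = "gradient \<phi>"
  have first: "first_variation V \<phi> $ i = (\<integral>p. (snd p *v ?g (fst p)) $ i \<partial>V)"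
    unfolding first_variation_def
    using integral_bounded_linear[OF bounded_linear_vec_nth integrable_first_variation[OF V \<phi>], of i]
    by (simp add: case_prod_beta)
  have G: "G_variation V i j k \<phi> = (\<integral>p. snd p $ j $ k * ((snd p *v ?g (fst p)) $ i) \<partial>V)" for i j k
    by (simp add: G_variation_def case_prod_beta' inner_axis)
  have int: "integrable V (\<lambda>p. snd p $ j $ k * ((snd p *v ?g (fst p)) $ i))" for i j k
    using integrable_G_variation[OF V \<phi>, of j k i] by (simp add: case_prod_beta' inner_axis)
  have sum: "(\<Sum>q\<in>UNIV. G_variation V (a q) (b q) q \<phi>) =
      (\<integral>p. (\<Sum>q\<in>UNIV. snd p $ b q $ q * ((snd p *v ?g (fst p)) $ a q)) \<partial>V)" for a b :: "'n \<Rightarrow> 'n"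
    unfolding G by (rule Bochner_Integration.integral_sum[symmetric]) (rule int)
  have "(\<Sum>q\<in>UNIV. G_variation V i q q \<phi>) = (\<integral>p. real d * (snd p *v ?g (fst p)) $ i \<partial>V)"
    unfolding sum
  proof (rule Bochner_Integration.integral_cong[OF refl])
    fix p assume "p \<in> space V"
    then have "trace (snd p) = real d"
      by (auto simp: space_varifold[OF V] grassmannian_iff)
    then show "(\<Sum>q\<in>UNIV. snd p $ q $ q * ((snd p *v ?g (fst p)) $ i)) = real d * (snd p *v ?g (fst p)) $ i"
      by (simp add: trace_def flip: sum_distrib_right)
  qed
  then show "(\<Sum>q\<in>UNIV. G_variation V i q q \<phi>) = real d * first_variation V \<phi> $ i"
    by (simp add: first)
  have "(\<Sum>q\<in>UNIV. G_variation V q i q \<phi>) = (\<integral>p. (snd p *v ?g (fst p)) $ i \<partial>V)"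
    unfolding sum
  proof (rule Bochner_Integration.integral_cong[OF refl])
    fix p assume "p \<in> space V"
    then have "snd p ** snd p = snd p"
      by (auto simp: space_varifold[OF V] grassmannian_iff)
    then have "snd p *v (snd p *v ?g (fst p)) = snd p *v ?g (fst p)"
      by (simp add: matrix_vector_mul_assoc)
    moreover have "(\<Sum>q\<in>UNIV. snd p $ i $ q * y $ q) = (snd p *v y) $ i" for y
      by (simp add: matrix_vector_mult_def)
    ultimately show "(\<Sum>q\<in>UNIV. snd p $ i $ q * ((snd p *v ?g (fst p)) $ q)) = (snd p *v ?g (fst p)) $ i"
      by simp
  qed
  then show "(\<Sum>q\<in>UNIV. G_variation V q i q \<phi>) = first_variation V \<phi> $ i"
    by (simp add: first)
qed

theorem proposition5p1:
  fixes \<Omega> :: "(real^'n) set"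
    and V :: "((real^'n) \<times> (real^'n^'n)) measure"
    and \<nu> :: "real^'n \<Rightarrow> (real^'n^'n) measure"
    and d :: nat
  assumes "1 \<le> d" and "d \<le> CARD('n)"
    and "open \<Omega>"
    and "varifold d \<Omega> V"
    and "bounded_variations \<Omega> V"
    and "disintegration d \<Omega> V \<nu>"
  defines "H \<equiv> mean_curvature \<Omega> V"
    and "c \<equiv> mean_projection \<nu>"
    and "\<beta> \<equiv> beta \<Omega> V"
    and "A \<equiv> weak_sff \<Omega> V \<nu>"
  shows
    "(\<forall>i j k. (\<forall>\<phi>\<in>C1c \<Omega>. G_variation V i j k \<phi> = G_variation V i k j \<phi>) \<and>
        (AE x in mass \<Omega> V. \<beta> i j k x = \<beta> i k j x) \<and>
        (AE x in mass \<Omega> V. A i j k x = A i k j x)) \<and>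
     (\<forall>i. (AE x in mass \<Omega> V. (\<Sum>q\<in>UNIV. \<beta> i q q x) = real d * H x $ i) \<and>
        (AE x in mass \<Omega> V. (\<Sum>q\<in>UNIV. \<beta> q i q x) = H x $ i)) \<and>
     (AE x in mass \<Omega> V. invertible (mat 1 + c x) \<and>
        (\<chi> i. \<Sum>q\<in>UNIV. A q i q x) = matrix_inv (mat 1 + c x) *v H x) \<and>
     (AE x in mass \<Omega> V.
        (\<chi> i. \<Sum>q\<in>UNIV. A i q q x) = real d *\<^sub>R (c x *v (matrix_inv (mat 1 + c x) *v H x)))"
proof -
  note V = \<open>varifold d \<Omega> V\<close>
  let ?M = "mass \<Omega> V"
  have M: "radon_measure_on \<Omega> ?M"
    by (rule mass_radon[OF V])
  have G_sr: "is_signed_radon \<Omega> (G_variation V i j k)" for i j k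
    using \<open>bounded_variations \<Omega> V\<close> by (simp add: bounded_variations_def)
  have G_ac: "is_ac_density \<Omega> ?M (G_variation V i j k) (ac_density \<Omega> ?M (G_variation V i j k))" for i j k
    by (rule is_ac_density_ac_density[OF \<open>open \<Omega>\<close> M G_sr])
  have "is_signed_radon \<Omega> (\<lambda>\<phi>. first_variation V \<phi> $ i)" for i
    using is_signed_radon_sum[of UNIV \<Omega> "\<lambda>q. G_variation V q i q", OF G_sr]
    by (simp add: is_signed_radon_def G_variation_trace_outer[OF V])
  then have H_ac: "is_ac_density \<Omega> ?M (\<lambda>\<phi>. first_variation V \<phi> $ i)
      (ac_density \<Omega> ?M (\<lambda>\<phi>. first_variation V \<phi> $ i))" for i
    by (rule is_ac_density_ac_density[OF \<open>open \<Omega>\<close> M])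
  have \<beta>_sym: "\<beta> i j k x = \<beta> i k j x" for i j k x
    using ac_density_cong[of \<Omega> "G_variation V i j k" "G_variation V i k j" ?M] G_variation_sym[OF V]
    by (simp add: \<beta>_def beta_def)
  have \<beta>_last: "AE x in ?M. (\<Sum>q\<in>UNIV. \<beta> i q q x) = real d * H x $ i" for i
  proof -
    have "AE x in ?M. (\<Sum>q\<in>UNIV. ac_density \<Omega> ?M (G_variation V i q q) x) =
        real d * ac_density \<Omega> ?M (\<lambda>\<phi>. first_variation V \<phi> $ i) x"
      by (rule ac_density_sum[OF \<open>open \<Omega>\<close> M finite G_ac H_ac G_variation_trace_last[OF V]])
    then show ?thesis
      by (simp add: \<beta>_def beta_def H_def mean_curvature_def sum_negf)
  qed
  have \<beta>_outer: "AE x in ?M. (\<Sum>q\<in>UNIV. \<beta> q i q x) = H x $ i" for i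
  proof -
    have "AE x in ?M. (\<Sum>q\<in>UNIV. ac_density \<Omega> ?M (G_variation V q i q) x) =
        1 * ac_density \<Omega> ?M (\<lambda>\<phi>. first_variation V \<phi> $ i) x"
      by (rule ac_density_sum[OF \<open>open \<Omega>\<close> M finite G_ac H_ac])
         (simp add: G_variation_trace_outer[OF V])
    then show ?thesis
      by (simp add: \<beta>_def beta_def H_def mean_curvature_def sum_negf)
  qed
  have "AE x in ?M. prob_space (\<nu> x) \<and> sets (\<nu> x) = sets (restrict_space borel (grassmannian d))"
    using \<open>disintegration d \<Omega> V \<nu>\<close> by (simp add: disintegration_def)
  moreover have "AE x in ?M. \<forall>i. (\<Sum>q\<in>UNIV. \<beta> i q q x) = real d * H x $ i"
    using \<beta>_last by (simp add: AE_all_countable)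
  moreover have "AE x in ?M. \<forall>i. (\<Sum>q\<in>UNIV. \<beta> q i q x) = H x $ i"
    using \<beta>_outer by (simp add: AE_all_countable)
  ultimately have main: "AE x in ?M. invertible (mat 1 + c x) \<and> (\<forall>i j k. A i j k x = A i k j x) \<and>
      (\<chi> i. \<Sum>q\<in>UNIV. A q i q x) = matrix_inv (mat 1 + c x) *v H x \<and>
      (\<chi> i. \<Sum>q\<in>UNIV. A i q q x) = real d *\<^sub>R (c x *v (matrix_inv (mat 1 + c x) *v H x))"
  proof eventually_elim
    case (elim x)
    note c = mean_projection_properties[of \<nu> x d, folded c_def]
    have inv: "invertible (mat 1 + c x)"
      using c(3) elim by (intro invertible_one_plus_psd) auto
    note solution = sff_system_solution[of "c x" "real d" "\<lambda>i j k. \<beta> i j k x" "H x",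
        OF inv c(1) c(2) \<beta>_sym]
    have A: "A i j k x = (THE a. \<forall>i j k. a i j k + c x $ j $ k * (\<Sum>q\<in>UNIV. a q i q) = \<beta> i j k x) i j k"
      for i j k
      by (simp add: A_def weak_sff_def c_def \<beta>_def)
    show ?case
      unfolding A using elim inv by (intro conjI allI solution) auto
  qed
  have A_sym: "AE x in ?M. A i j k x = A i k j x" for i j k
    using main by eventually_elim blast
  have A_outer: "AE x in ?M. invertible (mat 1 + c x) \<and>
      (\<chi> i. \<Sum>q\<in>UNIV. A q i q x) = matrix_inv (mat 1 + c x) *v H x"
    using main by eventually_elim blast
  have A_last: "AE x in ?M.
      (\<chi> i. \<Sum>q\<in>UNIV. A i q q x) = real d *\<^sub>R (c x *v (matrix_inv (mat 1 + c x) *v H x))"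
    using main by eventually_elim blast
  show ?thesis
    using G_variation_sym[OF V] \<beta>_last \<beta>_outer A_sym A_outer A_last
    by (intro conjI allI ballI) (simp_all add: \<beta>_sym)
qed

end
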